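(* Assume $R>1$ and that the model is uniformly well-posed, i.e. there is a constant $C>0$ with $\eta\ge C$ on $E$. Then there exists a global solution $f:E\to(0,\infty)$, $f\in C^2(E)$, of $$0=\tfrac12 b^2f''+\tilde a f'-R\eta f+Rf^{1-\frac1R}+\tfrac12\tfrac{1-R}{R}\rho^2b^2\frac{(f')^2}{f}\quad\text{on }E.$$
   Context: $E\subseteq\mathbb R$ is an open interval. $r,\lambda,\sigma,a,b,\rho,\delta:E\to\mathbb R$ are locally Lipschitz with $\sigma>0$, $b(y)\neq0$ and $\rho(y)\in[-1,1]$ for all $y$; $R\in(0,\infty)\setminus\{1\}$ is a constant. Define $\eta=\frac1R\big(\delta-(1-R)(r+\frac{\lambda^2}{2R})\big)$ and $\tilde a=a+\frac{1-R}{R}\rho\lambda b$. (These arise from a stochastic factor $dY=a(Y)dt+b(Y)d\tilde W$ correlated with the stock's Brownian motion with correlation $\rho(Y)$; the displayed equation is the reduced HJB equation for the value function ansatz $V=\frac{x^{1-R}}{1-R}f(y)$.) *)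

theory Defs
  imports "HOL-Analysis.Analysis"
begin

definition locally_lipschitz_on :: "real set \<Rightarrow> (real \<Rightarrow> real) \<Rightarrow> bool" where
  "locally_lipschitz_on E g \<longleftrightarrow>
     (\<forall>x\<in>E. \<exists>u>0. \<exists>L. lipschitz_on L (cball x u \<inter> E) g)"

definition eta_fun :: "real \<Rightarrow> (real \<Rightarrow> real) \<Rightarrow> (real \<Rightarrow> real) \<Rightarrow> (real \<Rightarrow> real) \<Rightarrow> real \<Rightarrow> real" where
  "eta_fun R \<delta> r lam y = (1 / R) * (\<delta> y - (1 - R) * (r y + (lam y)\<^sup>2 / (2 * R)))"

definition atilde_fun :: "real \<Rightarrow> (real \<Rightarrow> real) \<Rightarrow> (real \<Rightarrow> real) \<Rightarrow> (real \<Rightarrow> real) \<Rightarrow> (real \<Rightarrow> real) \<Rightarrow> real \<Rightarrow> real" where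
  "atilde_fun R a \<rho> lam b y = a y + ((1 - R) / R) * \<rho> y * lam y * b y"

end

theory Submission
  imports Defs
begin

text \<open>
  Writing \<open>f = exp u\<close> turns the equation into
  \<open>u'' = - q u'\<^sup>2 - A u' + P - B exp (- u / R)\<close> with \<open>B > 0\<close>, \<open>P / B = \<eta>\<close> and
  \<open>q = 1 - (R - 1) / R * \<rho>\<^sup>2 \<ge> 1 / R\<close>. Well-posedness makes a large constant \<open>M\<close> a
  supersolution. On a compact interval, cutting off \<open>u\<close> and \<open>u'\<close> makes the right-hand side bounded
  and Lipschitz, so shooting solves the problem with boundary values \<open>M\<close>. The maximum principle
  bounds \<open>u\<close>, and \<open>- q u'\<^sup>2\<close> bounds the slope, so the cut-off is inactive.
  On an interior interval there are bounds not depending on the interval of solution: at a maximum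
  of \<open>(t - a) (b - t) exp (- u / (2 R))\<close> the equation bounds that function, hence \<open>u\<close> from
  below; the mean value theorem gives points of moderate slope, from which the Riccati barrier
  spreads. Along an exhaustion of \<open>E\<close>, a subsequence converges in \<open>(u, u')\<close> at one point, hence by
  continuous dependence locally uniformly on all of \<open>E\<close>.
\<close>

section \<open>Ordinary differential equations on compact intervals\<close>

text \<open>The Lipschitz bound is global in the state, so Picard iteration reaches \<open>b\<close>
  in one stroke and no local solutions have to be glued.\<close>

lemma picard_lindelof_interval:
  fixes f :: "real \<Rightarrow> 'a::banach \<Rightarrow> 'a"
  assumes ab: "a \<le> b"
    and cont: "continuous_on ({a..b} \<times> UNIV) (\<lambda>(t, x). f t x)"
    and lip: "\<And>t x y. t \<in> {a..b} \<Longrightarrow> norm (f t x - f t y) \<le> L * norm (x - y)"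
  obtains x where "x a = x0"
    and "\<And>t. t \<in> {a..b} \<Longrightarrow> (x has_vector_derivative f t (x t)) (at t within {a..b})"
proof -
  define K where "K = max L 1"
  have K: "K \<ge> 1" "\<And>t x y. t \<in> {a..b} \<Longrightarrow> norm (f t x - f t y) \<le> K * norm (x - y)"
    using lip unfolding K_def by (auto intro: order_trans[OF lip mult_right_mono])
  \<comment> \<open>In the sup norm weighted by \<open>1 / e\<close> the Picard operator is a contraction on all of \<open>[a, b]\<close> at once.\<close>
  define e where "e t = exp (2 * K * (t - a))" for t
  have e_pos: "e t > 0" for t by (simp add: e_def)
  have e_cont: "continuous_on S e" for S unfolding e_def by (intro continuous_intros)
  define G where "G g s = f s (e s *\<^sub>R g s)" for g :: "real \<Rightarrow> 'a" and s
  have G_cont: "continuous_on {a..b} (G g)" if "continuous_on UNIV g" for g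
  proof -
    have "continuous_on {a..b} (\<lambda>s. (\<lambda>(t, x). f t x) (s, e s *\<^sub>R g s))"
      using that
      by (intro continuous_on_compose2[OF cont] continuous_intros e_cont)
         (auto intro: continuous_on_subset)
    then show ?thesis by (simp add: G_def)
  qed
  \<comment> \<open>The Picard operator conjugated by the weight: \<open>x = e *\<^sub>R g\<close>
    satisfies the integral equation on \<open>[a, b]\<close> exactly when \<open>g\<close> is fixed
    by \<open>H\<close> there.\<close>
  define H where "H g t = (1 / e t) *\<^sub>R (x0 + integral {a..t} (G g))" for g t
  have H_cont: "continuous_on {a..b} (H g)" if "continuous_on UNIV g" for g
    unfolding H_def using e_pos
    by (intro continuous_intros e_cont indefinite_integral_continuous_1 integrable_continuous_real
        G_cont that) (metis less_irrefl)
  \<comment> \<open>Bounded continuous functions live on the whole real line; the retraction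
    \<open>p\<close> extends values constantly beyond \<open>[a, b]\<close>.\<close>
  define p where "p t = max a (min b t)" for t
  have p_in: "p t \<in> {a..b}" for t using ab by (auto simp: p_def)
  have p_id: "p t = t" if "t \<in> {a..b}" for t using that by (auto simp: p_def)
  have p_cont: "continuous_on UNIV p" unfolding p_def by (intro continuous_intros)
  define T where "T g = Bcontfun (\<lambda>t. H (apply_bcontfun g) (p t))" for g :: "real \<Rightarrow>\<^sub>C 'a"
  have T_apply: "apply_bcontfun (T g) t = H (apply_bcontfun g) (p t)" for g t
  proof -
    have "(\<lambda>t. H (apply_bcontfun g) (p t)) \<in> bcontfun"
      unfolding bcontfun_def
    proof (intro CollectI conjI)
      show "continuous_on UNIV (\<lambda>t. H (apply_bcontfun g) (p t))"
        using p_in by (intro continuous_on_compose2[OF H_cont p_cont]) auto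
      have "bounded (H (apply_bcontfun g) ` {a..b})"
        by (intro compact_imp_bounded compact_continuous_image H_cont) auto
      then show "bounded (range (\<lambda>t. H (apply_bcontfun g) (p t)))"
        by (rule bounded_subset) (use p_in in auto)
    qed
    then show ?thesis by (simp add: T_def Bcontfun_inverse)
  qed
  have H_dist: "dist (H (apply_bcontfun g) t) (H (apply_bcontfun h) t) \<le> 1/2 * dist g h"
    if t: "t \<in> {a..b}" for g h :: "real \<Rightarrow>\<^sub>C 'a" and t
  proof -
    define D where "D = dist g h"
    have gh: "norm (apply_bcontfun g s - apply_bcontfun h s) \<le> D" for s
      unfolding D_def dist_norm[symmetric] by (rule dist_bounded)
    have int: "G (apply_bcontfun k) integrable_on {a..t}" for k
      using t by (intro integrable_continuous_real continuous_on_subset[OF G_cont]) auto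
    have D: "D \<ge> 0" by (simp add: D_def)
    \<comment> \<open>The rate \<open>2 * K\<close> in \<open>e\<close> produces the factor 1/2
      here, and with it the contraction constant.\<close>
    have ge: "((\<lambda>s. K * (e s * D)) has_integral (e t * D / 2 - e a * D / 2)) {a..t}"
      unfolding e_def using t K(1)
      by (intro fundamental_theorem_of_calculus)
         (auto intro!: derivative_eq_intros simp: has_real_derivative_iff_has_vector_derivative[symmetric] field_simps)
    have "norm (integral {a..t} (\<lambda>s. G (apply_bcontfun g) s - G (apply_bcontfun h) s))
        \<le> integral {a..t} (\<lambda>s. K * (e s * D))"
    proof (rule integral_norm_bound_integral)
      fix s assume s: "s \<in> {a..t}"
      have "norm (G (apply_bcontfun g) s - G (apply_bcontfun h) s)
          \<le> K * norm (e s *\<^sub>R apply_bcontfun g s - e s *\<^sub>R apply_bcontfun h s)"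
        unfolding G_def using s t by (intro K(2)) auto
      also have "\<dots> = K * (e s * norm (apply_bcontfun g s - apply_bcontfun h s))"
        using e_pos[of s] by (simp add: scaleR_diff_right[symmetric])
      also have "\<dots> \<le> K * (e s * D)"
        using gh[of s] e_pos[of s] K(1) by (intro mult_left_mono) auto
      finally show "norm (G (apply_bcontfun g) s - G (apply_bcontfun h) s) \<le> K * (e s * D)" .
    qed (use int ge in \<open>auto intro: integrable_diff has_integral_integrable\<close>)
    also have "\<dots> = e t * D / 2 - e a * D / 2"
      using ge by (rule integral_unique)
    also have "\<dots> \<le> e t * D / 2" using D e_pos[of a] by simp
    finally have *: "norm (integral {a..t} (G (apply_bcontfun g)) - integral {a..t} (G (apply_bcontfun h)))
       \<le> e t * D / 2"
      by (simp add: integral_diff int)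
    have "dist (H (apply_bcontfun g) t) (H (apply_bcontfun h) t)
      = (1 / e t) * norm (integral {a..t} (G (apply_bcontfun g)) - integral {a..t} (G (apply_bcontfun h)))"
      using e_pos[of t] by (simp add: dist_norm H_def scaleR_diff_right[symmetric])
    also have "\<dots> \<le> (1 / e t) * (e t * D / 2)"
      using * e_pos[of t] by (intro mult_left_mono) auto
    finally show ?thesis using e_pos[of t] by (simp add: D_def)
  qed
  have "\<exists>!g. T g = g"
  proof (rule banach_fix_type[of "1/2"], simp_all, intro allI)
    fix g h show "dist (T g) (T h) * 2 \<le> dist g h"
      using dist_bound[of "T g" "T h" "1/2 * dist g h"] H_dist p_in by (simp add: T_apply)
  qed
  then obtain g where g: "T g = g" by blast
  define x where "x t = e t *\<^sub>R apply_bcontfun g t" for t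
  have x_eq: "x t = x0 + integral {a..t} (G (apply_bcontfun g))" if "t \<in> {a..b}" for t
  proof -
    have "apply_bcontfun g t = H (apply_bcontfun g) t"
      using T_apply[of g t] g p_id[OF that] by simp
    then show ?thesis using e_pos[of t] unfolding x_def H_def by simp
  qed
  show thesis
  proof
    show "x a = x0" using x_eq[of a] ab by simp
  next
    fix t assume t: "t \<in> {a..b}"
    have "((\<lambda>t. x0 + integral {a..t} (G (apply_bcontfun g))) has_vector_derivative
        0 + G (apply_bcontfun g) t) (at t within {a..b})"
      using t by (intro derivative_intros integral_has_vector_derivative G_cont) auto
    then show "(x has_vector_derivative f t (x t)) (at t within {a..b})"
      using t by (subst has_vector_derivative_cong_ev[where g="\<lambda>t. x0 + integral {a..t} (G (apply_bcontfun g))"])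
        (auto simp: x_eq G_def x_def[symmetric] eventually_at_filter)
  qed
qed

section \<open>Mean values, Gronwall estimate and continuous dependence\<close>

lemma mvt_within:
  fixes f :: "real \<Rightarrow> real"
  assumes st: "s < t" "{s..t} \<subseteq> S"
    and f: "\<And>x. x \<in> S \<Longrightarrow> (f has_real_derivative f' x) (at x within S)"
  obtains \<xi> where "s < \<xi>" "\<xi> < t" "f t - f s = f' \<xi> * (t - s)"
proof -
  have "\<exists>\<xi>\<in>{s<..<t}. f t - f s = (\<lambda>h. f' \<xi> * h) (t - s)"
  proof (rule mvt_simple[OF st(1)])
    fix x assume "s \<le> x" "x \<le> t"
    then have "(f has_real_derivative f' x) (at x within {s..t})"
      using st by (intro DERIV_subset[OF f]) auto
    then show "(f has_derivative (*) (f' x)) (at x within {s..t})"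
      by (simp add: has_field_derivative_def)
  qed
  then show thesis using that by auto
qed

text \<open>\<open>z \<bullet> z\<close> is differentiable even where the norm is not.
  Cauchy-Schwarz bounds its derivative by \<open>2 * L\<close> times itself, so it becomes
  nonincreasing after multiplication by \<open>exp (- 2 * L * r)\<close> and nondecreasing after
  multiplication by \<open>exp (2 * L * r)\<close>; the two factors treat \<open>s < t\<close> and
  \<open>t < s\<close>.\<close>

lemma gronwall_norm:
  fixes z z' :: "real \<Rightarrow> 'a::real_inner"
  assumes z: "\<And>t. t \<in> {a..b} \<Longrightarrow> (z has_vector_derivative z' t) (at t within {a..b})"
    and le: "\<And>t. t \<in> {a..b} \<Longrightarrow> norm (z' t) \<le> L * norm (z t)"
    and st: "s \<in> {a..b}" "t \<in> {a..b}"
  shows "norm (z t) \<le> exp (L * \<bar>t - s\<bar>) * norm (z s)"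
proof -
  have inner_le: "\<bar>z r \<bullet> z' r\<bar> \<le> L * (z r \<bullet> z r)" if "r \<in> {a..b}" for r
  proof -
    have "\<bar>z r \<bullet> z' r\<bar> \<le> norm (z r) * norm (z' r)" by (rule Cauchy_Schwarz_ineq2)
    also have "\<dots> \<le> norm (z r) * (L * norm (z r))" using le[OF that] by (intro mult_left_mono) auto
    finally show ?thesis by (simp add: dot_square_norm power2_eq_square mult_ac)
  qed
  define h where "h c r = (z r \<bullet> z r) * exp (c * r)" for c r
  have h: "(h c has_real_derivative (2 * (z r \<bullet> z' r) + c * (z r \<bullet> z r)) * exp (c * r)) (at r within {a..b})"
    if "r \<in> {a..b}" for c r
  proof -
    have "((\<lambda>r. z r \<bullet> z r) has_real_derivative 2 * (z r \<bullet> z' r)) (at r within {a..b})"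
      using has_derivative_inner[OF z[OF that, unfolded has_vector_derivative_def]
          z[OF that, unfolded has_vector_derivative_def]]
      unfolding has_field_derivative_def
      by (rule has_derivative_eq_rhs) (simp add: fun_eq_iff inner_commute)
    then show ?thesis unfolding h_def
      by (auto intro!: derivative_eq_intros simp: algebra_simps)
  qed
  have sq: "(norm (z t))\<^sup>2 \<le> (exp (L * \<bar>t - s\<bar>) * norm (z s))\<^sup>2"
  proof (cases s t rule: linorder_cases)
    case equal then show ?thesis by simp
  next
    case less
    have "{s..t} \<subseteq> {a..b}" using st by auto
    then obtain \<xi> where \<xi>: "s < \<xi>" "\<xi> < t"
      "h (- 2 * L) t - h (- 2 * L) s
        = (2 * (z \<xi> \<bullet> z' \<xi>) + (- 2 * L) * (z \<xi> \<bullet> z \<xi>)) * exp ((- 2 * L) * \<xi>) * (t - s)"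
      using mvt_within[OF less _ h] by metis
    have "2 * (z \<xi> \<bullet> z' \<xi>) + (- 2 * L) * (z \<xi> \<bullet> z \<xi>) \<le> 0"
      using inner_le[of \<xi>] \<xi> st by auto
    then have "h (- 2 * L) t - h (- 2 * L) s \<le> 0"
      unfolding \<xi>(3) using less by (intro mult_nonpos_nonneg) auto
    then have "(z t \<bullet> z t) * exp (- 2 * L * t) * exp (2 * L * t)
        \<le> (z s \<bullet> z s) * exp (- 2 * L * s) * exp (2 * L * t)"
      unfolding h_def by (intro mult_right_mono) auto
    then have "(z t \<bullet> z t) \<le> (z s \<bullet> z s) * exp (2 * L * (t - s))"
      by (simp add: mult.assoc exp_add[symmetric] algebra_simps)
    then show ?thesis using less
      by (simp add: power_mult_distrib dot_square_norm exp_double[symmetric] mult_ac)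
  next
    case greater
    have "{t..s} \<subseteq> {a..b}" using st by auto
    then obtain \<xi> where \<xi>: "t < \<xi>" "\<xi> < s"
      "h (2 * L) s - h (2 * L) t
        = (2 * (z \<xi> \<bullet> z' \<xi>) + (2 * L) * (z \<xi> \<bullet> z \<xi>)) * exp ((2 * L) * \<xi>) * (s - t)"
      using mvt_within[OF greater _ h] by metis
    have "2 * (z \<xi> \<bullet> z' \<xi>) + (2 * L) * (z \<xi> \<bullet> z \<xi>) \<ge> 0"
      using inner_le[of \<xi>] \<xi> st by auto
    then have "h (2 * L) s - h (2 * L) t \<ge> 0"
      unfolding \<xi>(3) using greater by (intro mult_nonneg_nonneg) auto
    then have "(z t \<bullet> z t) * exp (2 * L * t) * exp (- 2 * L * t)
        \<le> (z s \<bullet> z s) * exp (2 * L * s) * exp (- 2 * L * t)"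
      unfolding h_def by (intro mult_right_mono) auto
    then have "(z t \<bullet> z t) \<le> (z s \<bullet> z s) * exp (2 * L * (s - t))"
      by (simp add: mult.assoc exp_add[symmetric] algebra_simps)
    then show ?thesis using greater
      by (simp add: power_mult_distrib dot_square_norm exp_double[symmetric] mult_ac)
  qed
  then show ?thesis by (rule power2_le_imp_le) auto
qed

corollary ode_continuous_dependence:
  fixes f :: "real \<Rightarrow> 'a::real_inner \<Rightarrow> 'a"
  assumes lip: "\<And>t x y. t \<in> {a..b} \<Longrightarrow> norm (f t x - f t y) \<le> L * norm (x - y)"
    and x: "\<And>t. t \<in> {a..b} \<Longrightarrow> (x has_vector_derivative f t (x t)) (at t within {a..b})"
    and y: "\<And>t. t \<in> {a..b} \<Longrightarrow> (y has_vector_derivative f t (y t)) (at t within {a..b})"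
    and st: "s \<in> {a..b}" "t \<in> {a..b}"
  shows "norm (x t - y t) \<le> exp (L * \<bar>t - s\<bar>) * norm (x s - y s)"
  by (rule gronwall_norm[where z="\<lambda>t. x t - y t" and z'="\<lambda>t. f t (x t) - f t (y t)"])
     (use assms in \<open>auto intro: has_vector_derivative_diff\<close>)

section \<open>Second-order equations as systems, shooting and limits of solutions\<close>

lemma has_vector_derivative_Pair_iff:
  fixes u v :: "real \<Rightarrow> real"
  shows "((\<lambda>t. (u t, v t)) has_vector_derivative (u', v')) (at t within S) \<longleftrightarrow>
    (u has_real_derivative u') (at t within S) \<and> (v has_real_derivative v') (at t within S)"
  (is "?L \<longleftrightarrow> ?R")
proof
  assume ?L
  then show ?R
    using bounded_linear.has_vector_derivative[OF bounded_linear_fst, of "\<lambda>t. (u t, v t)" "(u', v')"]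
      bounded_linear.has_vector_derivative[OF bounded_linear_snd, of "\<lambda>t. (u t, v t)" "(u', v')"]
    by (simp add: has_real_derivative_iff_has_vector_derivative)
next
  assume ?R
  then show ?L
    unfolding has_real_derivative_iff_has_vector_derivative
    by (auto intro: has_vector_derivative_Pair)
qed

text \<open>Used to pass from a scalar equation \<open>u'' = g\<close> to the system for
  \<open>(u, u')\<close>; the first component contributes the summand 1.\<close>

lemma second_order_system_lipschitz:
  fixes g :: "real \<times> real \<Rightarrow> real"
  assumes "\<bar>g x - g y\<bar> \<le> L * norm (x - y)"
  shows "norm ((snd x, g x) - (snd y, g y)) \<le> (1 + L) * norm (x - y)"
proof -
  have "norm ((snd x, g x) - (snd y, g y)) \<le> \<bar>snd x - snd y\<bar> + \<bar>g x - g y\<bar>"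
    using norm_Pair_le[of "snd x - snd y" "g x - g y"] by simp
  also have "\<dots> \<le> norm (x - y) + L * norm (x - y)"
    using norm_snd_le[of "snd (x - y)" "fst (x - y)"] assms
    by (intro add_mono) (auto simp: minus_prod_def)
  finally show ?thesis by (simp add: algebra_simps)
qed

text \<open>Shooting: the boundary value at \<open>b\<close> depends continuously on the initial slope and, since
  \<open>F\<close> is bounded, takes arbitrarily large and small values.\<close>

lemma bounded_lipschitz_bvp:
  fixes F :: "real \<Rightarrow> real \<Rightarrow> real \<Rightarrow> real"
  assumes ab: "a < b"
    and cont: "continuous_on ({a..b} \<times> UNIV) (\<lambda>(t, x). F t (fst x) (snd x))"
    and lip: "\<And>t x y. t \<in> {a..b} \<Longrightarrow>
      \<bar>F t (fst x) (snd x) - F t (fst y) (snd y)\<bar> \<le> L * norm (x - y)"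
    and bnd: "\<And>t x y. t \<in> {a..b} \<Longrightarrow> \<bar>F t x y\<bar> \<le> K"
  obtains u v where "u a = p" "u b = q"
    "\<And>t. t \<in> {a..b} \<Longrightarrow> (u has_real_derivative v t) (at t within {a..b})"
    "\<And>t. t \<in> {a..b} \<Longrightarrow> (v has_real_derivative F t (u t) (v t)) (at t within {a..b})"
proof -
  define f where "f t x = (snd x, F t (fst x) (snd x))" for t and x :: "real \<times> real"
  have f_cont: "continuous_on ({a..b} \<times> UNIV) (\<lambda>(t, x). f t x)"
    using cont unfolding f_def case_prod_beta by (intro continuous_intros)
  have f_lip: "norm (f t x - f t y) \<le> (1 + L) * norm (x - y)" if "t \<in> {a..b}" for t x y
    unfolding f_def by (intro second_order_system_lipschitz lip that)
  have "\<exists>X. X a = (p, s) \<and> (\<forall>t\<in>{a..b}. (X has_vector_derivative f t (X t)) (at t within {a..b}))" for s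
    using picard_lindelof_interval[OF less_imp_le[OF ab] f_cont f_lip, of "(p, s)"] by metis
  then obtain X where X0: "\<And>s. X s a = (p, s)"
    and X: "\<And>s t. t \<in> {a..b} \<Longrightarrow> (X s has_vector_derivative f t (X s t)) (at t within {a..b})"
    by metis
  define u where "u s t = fst (X s t)" for s t
  define v where "v s t = snd (X s t)" for s t
  have uv: "(u s has_real_derivative v s t) (at t within {a..b}) \<and>
      (v s has_real_derivative F t (u s t) (v s t)) (at t within {a..b})" if "t \<in> {a..b}" for s t
    using X[OF that, of s] unfolding has_vector_derivative_Pair_iff[symmetric]
    by (simp add: u_def v_def f_def)
  define C where "C = exp ((1 + L) * (b - a))"
  have dep: "\<bar>u s b - u s' b\<bar> \<le> C * \<bar>s - s'\<bar>" for s s'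
  proof -
    have "\<bar>u s b - u s' b\<bar> \<le> norm (X s b - X s' b)"
      using norm_fst_le[of "fst (X s b - X s' b)" "snd (X s b - X s' b)"]
      by (simp add: u_def minus_prod_def)
    also have "\<dots> \<le> exp ((1 + L) * \<bar>b - a\<bar>) * norm (X s a - X s' a)"
      using ab by (intro ode_continuous_dependence[OF f_lip X X]) auto
    also have "\<dots> = C * \<bar>s - s'\<bar>" using ab by (simp add: X0 C_def)
    finally show ?thesis .
  qed
  have "C-lipschitz_on UNIV (\<lambda>s. u s b)"
    using dep by (intro lipschitz_onI) (auto simp: dist_real_def C_def)
  then have u_cont: "continuous_on UNIV (\<lambda>s. u s b)" by (rule lipschitz_on_continuous_on)
  have K: "K \<ge> 0" using bnd[of a 0 0] ab by auto
  \<comment> \<open>A bounded right-hand side keeps the slope within \<open>K * (b - a)\<close> of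
    its initial value, however large that is, so the end value is linear in \<open>s\<close> up to a
    bounded error.\<close>
  have v_near: "\<bar>v s t - s\<bar> \<le> K * (b - a)" if t: "a < t" "t \<le> b" for s t
  proof -
    obtain \<xi> where \<xi>: "a < \<xi>" "\<xi> < t" "v s t - v s a = F \<xi> (u s \<xi>) (v s \<xi>) * (t - a)"
      using mvt_within[of a t "{a..b}" "v s" "\<lambda>t. F t (u s t) (v s t)"] uv t by auto
    have "\<bar>F \<xi> (u s \<xi>) (v s \<xi>)\<bar> * \<bar>t - a\<bar> \<le> K * (b - a)"
      using bnd[of \<xi>] \<xi> t K by (intro mult_mono) auto
    then show ?thesis using \<xi>(3) by (simp add: v_def X0 abs_mult)
  qed
  have u_near: "\<bar>u s b - p - s * (b - a)\<bar> \<le> K * (b - a) * (b - a)" for s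
  proof -
    obtain \<xi> where \<xi>: "a < \<xi>" "\<xi> < b" "u s b - u s a = v s \<xi> * (b - a)"
      using mvt_within[of a b "{a..b}" "u s" "v s"] uv ab by auto
    have "u s b - p - s * (b - a) = (v s \<xi> - s) * (b - a)"
      using \<xi>(3) by (simp add: u_def X0 algebra_simps)
    then show ?thesis using v_near[of \<xi> s] \<xi> ab by (simp add: abs_mult)
  qed
  \<comment> \<open>The gain \<open>S * (b - a)\<close> covers both the error in
    \<open>u_near\<close> and the gap \<open>\<bar>q - p\<bar>\<close>, so the slopes
    \<open>S\<close> and \<open>- S\<close> bring the end value to \<open>q\<close> or beyond, from
    opposite sides.\<close>
  define S where "S = (\<bar>q - p\<bar> + K * (b - a) * (b - a)) / (b - a)"
  have S: "S * (b - a) = \<bar>q - p\<bar> + K * (b - a) * (b - a)" using ab by (simp add: S_def)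
  have S0: "S \<ge> 0" using ab K by (simp add: S_def)
  have "\<exists>s\<ge>-S. s \<le> S \<and> u s b = q"
    using u_near[of S] u_near[of "-S"] S S0
    by (intro IVT') (auto intro: continuous_on_subset[OF u_cont])
  then obtain s where s: "u s b = q" by blast
  show thesis by (rule that[of "u s" "v s"]) (use s uv X0 in \<open>auto simp: u_def\<close>)
qed

text \<open>Convergence at the single point \<open>s\<close> suffices: continuous dependence carries
  it uniformly over \<open>[a, b]\<close>, and the Lipschitz bound then makes the derivatives
  converge uniformly.\<close>

lemma ode_sequence_limit:
  fixes f :: "real \<Rightarrow> 'a::{real_inner, banach} \<Rightarrow> 'a"
  assumes lip: "\<And>t x y. t \<in> {a..b} \<Longrightarrow> norm (f t x - f t y) \<le> L * norm (x - y)"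
    and X: "\<And>n t. t \<in> {a..b} \<Longrightarrow> (X n has_vector_derivative f t (X n t)) (at t within {a..b})"
    and s: "s \<in> {a..b}" and lim: "(\<lambda>n. X n s) \<longlonglongrightarrow> l"
  obtains Y where "\<And>t. t \<in> {a..b} \<Longrightarrow> (\<lambda>n. X n t) \<longlonglongrightarrow> Y t"
    "\<And>t. t \<in> {a..b} \<Longrightarrow> (Y has_vector_derivative f t (Y t)) (at t within {a..b})"
proof -
  define K where "K = max L 0"
  have K: "norm (f t x - f t y) \<le> K * norm (x - y)" if "t \<in> {a..b}" for t x y
    by (rule order_trans[OF lip[OF that]]) (simp add: K_def mult_right_mono)
  have K0: "K \<ge> 0" by (simp add: K_def)
  define C where "C = exp (K * (b - a))"
  have dep: "norm (X n t - X m t) \<le> C * norm (X n s - X m s)" if t: "t \<in> {a..b}" for n m t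
  proof -
    have "norm (X n t - X m t) \<le> exp (K * \<bar>t - s\<bar>) * norm (X n s - X m s)"
      by (rule ode_continuous_dependence[OF K X X s t])
    also have "\<dots> \<le> C * norm (X n s - X m s)"
      unfolding C_def using s t K0 by (intro mult_right_mono) (auto intro!: mult_left_mono)
    finally show ?thesis .
  qed
  have C0: "C > 0" by (simp add: C_def)
  have "Cauchy (\<lambda>n. X n t)" if t: "t \<in> {a..b}" for t
  proof (rule metric_CauchyI)
    fix e :: real assume "e > 0"
    then obtain M where M: "\<And>m n. m \<ge> M \<Longrightarrow> n \<ge> M \<Longrightarrow> dist (X m s) (X n s) < e / C"
      using metric_CauchyD[OF LIMSEQ_imp_Cauchy[OF lim], of "e / C"] C0 by auto
    show "\<exists>M. \<forall>m\<ge>M. \<forall>n\<ge>M. dist (X m t) (X n t) < e"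
    proof (intro exI allI impI)
      fix m n assume "m \<ge> M" "n \<ge> M"
      then have "C * norm (X m s - X n s) < e"
        using M[of m n] C0 by (simp add: dist_norm field_simps)
      then show "dist (X m t) (X n t) < e" using dep[OF t, of m n] by (simp add: dist_norm)
    qed
  qed
  then have "\<exists>y. (\<lambda>n. X n t) \<longlonglongrightarrow> y" if "t \<in> {a..b}" for t
    using that Cauchy_convergent convergent_def by blast
  then obtain Y where Y: "\<And>t. t \<in> {a..b} \<Longrightarrow> (\<lambda>n. X n t) \<longlonglongrightarrow> Y t" by metis
  \<comment> \<open>Letting \<open>m\<close> tend to infinity in \<open>dep\<close> gives a rate of
    convergence that does not depend on \<open>t\<close>.\<close>
  have dist_Y: "norm (X n t - Y t) \<le> C * norm (X n s - l)" if "t \<in> {a..b}" for n t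
  proof (rule LIMSEQ_le)
    show "(\<lambda>m. norm (X n t - X m t)) \<longlonglongrightarrow> norm (X n t - Y t)"
      by (intro tendsto_intros Y that)
    show "(\<lambda>m. C * norm (X n s - X m s)) \<longlonglongrightarrow> C * norm (X n s - l)"
      by (intro tendsto_intros lim)
  qed (use dep[OF that] in blast)
  \<comment> \<open>The derivative is expressed through the pointwise limit \<open>Y\<close>;
    uniqueness of limits later identifies \<open>g\<close> with \<open>Y\<close>, which closes the
    equation.\<close>
  have "\<exists>g. \<forall>x\<in>{a..b}. (\<lambda>n. X n x) \<longlonglongrightarrow> g x \<and> (g has_derivative (\<lambda>h. h *\<^sub>R f x (Y x))) (at x within {a..b})"
  proof (rule has_derivative_sequence[where f=X and f'="\<lambda>n x h. h *\<^sub>R f x (X n x)" and ?x0.0=s and l=l])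
    show "\<And>n x. x \<in> {a..b} \<Longrightarrow> (X n has_derivative (\<lambda>h. h *\<^sub>R f x (X n x))) (at x within {a..b})"
      using X by (simp add: has_vector_derivative_def)
    fix e :: real assume e: "e > 0"
    have "(\<lambda>n. K * (C * norm (X n s - l))) \<longlonglongrightarrow> K * (C * norm (l - l))"
      by (intro tendsto_intros lim)
    then have "\<forall>\<^sub>F n in sequentially. K * (C * norm (X n s - l)) < e"
      using e by (intro order_tendstoD(2)) auto
    then show "\<forall>\<^sub>F n in sequentially. \<forall>x\<in>{a..b}. \<forall>h.
        norm (h *\<^sub>R f x (X n x) - h *\<^sub>R f x (Y x)) \<le> e * norm h"
    proof (eventually_elim, intro ballI allI)
      fix n x and h :: real assume n: "K * (C * norm (X n s - l)) < e" and x: "x \<in> {a..b}"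
      have "norm (f x (X n x) - f x (Y x)) \<le> K * norm (X n x - Y x)" by (rule K[OF x])
      also have "\<dots> \<le> K * (C * norm (X n s - l))" by (intro mult_left_mono dist_Y x K0)
      finally have "norm (f x (X n x) - f x (Y x)) \<le> e" using n by simp
      then have "\<bar>h\<bar> * norm (f x (X n x) - f x (Y x)) \<le> \<bar>h\<bar> * e" by (intro mult_left_mono) auto
      then show "norm (h *\<^sub>R f x (X n x) - h *\<^sub>R f x (Y x)) \<le> e * norm h"
        by (simp add: scaleR_diff_right[symmetric] mult.commute)
    qed
  qed (use s lim in auto)
  then obtain g where "\<forall>x\<in>{a..b}. (\<lambda>n. X n x) \<longlonglongrightarrow> g x \<and> (g has_vector_derivative f x (Y x)) (at x within {a..b})"
    unfolding has_vector_derivative_def by blast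
  then have g: "\<And>x. x \<in> {a..b} \<Longrightarrow> (\<lambda>n. X n x) \<longlonglongrightarrow> g x"
    "\<And>x. x \<in> {a..b} \<Longrightarrow> (g has_vector_derivative f x (Y x)) (at x within {a..b})"
    by blast+
  have "g x = Y x" if "x \<in> {a..b}" for x
    using LIMSEQ_unique[OF g(1)[OF that] Y[OF that]] .
  with g show thesis by (intro that[of g]) auto
qed

section \<open>Maximum principle and barriers\<close>

text \<open>If \<open>D\<close> were positive, \<open>w'\<close> would be positive just to the right
  of its zero \<open>y\<close>, and by the mean value theorem \<open>w\<close> would rise above its
  maximum.\<close>

lemma interior_max_second_derivative:
  fixes w :: "real \<Rightarrow> real"
  assumes y: "a < y" "y < b"
    and max: "\<And>t. t \<in> {a..b} \<Longrightarrow> w t \<le> w y"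
    and w: "\<And>t. t \<in> {a..b} \<Longrightarrow> (w has_real_derivative w' t) (at t within {a..b})"
    and w': "(w' has_real_derivative D) (at y within {a..b})"
  shows "w' y = 0" "D \<le> 0"
proof -
  have "(w has_real_derivative w' y) (at y)"
    using w[of y] y by (simp add: at_within_Icc_at)
  then show w'0: "w' y = 0"
    by (rule DERIV_local_max[of _ _ _ "min (y - a) (b - y)"]) (use y in \<open>auto intro!: max simp: abs_if split: if_splits\<close>)
  show "D \<le> 0"
  proof (rule ccontr)
    assume "\<not> D \<le> 0"
    then obtain d where d: "d > 0" "\<And>h. h > 0 \<Longrightarrow> y + h \<in> {a..b} \<Longrightarrow> h < d \<Longrightarrow> w' y < w' (y + h)"
      using has_real_derivative_pos_inc_right[OF w'] by auto
    define h where "h = min (d / 2) (b - y)"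
    have h: "h > 0" "h < d" "y + h \<le> b" using d y by (auto simp: h_def)
    obtain \<xi> where \<xi>: "y < \<xi>" "\<xi> < y + h" "w (y + h) - w y = w' \<xi> * (y + h - y)"
      using mvt_within[of y "y + h" "{a..b}" w w'] w h y by auto
    have "w' \<xi> > 0" using d(2)[of "\<xi> - y"] \<xi> h y w'0 by auto
    then have "w' \<xi> * h > 0" using h by simp
    then have "w (y + h) > w y" using \<xi>(3) by simp
    moreover have "w (y + h) \<le> w y" using h y by (intro max) auto
    ultimately show False by simp
  qed
qed

text \<open>A maximum of \<open>v\<close> above \<open>N\<close> is not at \<open>a\<close>, and the
  negative derivative there gives larger values to its left. Looking only to the left also covers a
  maximum at \<open>b\<close>.\<close>

lemma barrier_above:
  fixes v :: "real \<Rightarrow> real"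
  assumes v: "\<And>t. t \<in> {a..b} \<Longrightarrow> (v has_real_derivative v' t) (at t within {a..b})"
    and start: "v a \<le> N"
    and neg: "\<And>t. t \<in> {a..b} \<Longrightarrow> v t > N \<Longrightarrow> v' t < 0"
    and t: "t \<in> {a..b}"
  shows "v t \<le> N"
proof -
  have "continuous_on {a..b} v" using v by (rule DERIV_continuous_on)
  then obtain y where y: "y \<in> {a..b}" "\<And>t. t \<in> {a..b} \<Longrightarrow> v t \<le> v y"
    using continuous_attains_sup[of "{a..b}" v] t by auto
  have "v y \<le> N"
  proof (rule ccontr)
    assume "\<not> v y \<le> N"
    then have y': "a < y" "v' y < 0" using start neg[OF y(1)] y(1) by (auto simp: le_less)
    from has_real_derivative_neg_dec_left[OF v[OF y(1)] y'(2)]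
    obtain d where d: "d > 0" "\<And>h. h > 0 \<Longrightarrow> y - h \<in> {a..b} \<Longrightarrow> h < d \<Longrightarrow> v y < v (y - h)"
      by blast
    define h where "h = min (d / 2) (y - a)"
    have "h > 0" "h < d" "y - h \<in> {a..b}" using d(1) y' y(1) by (auto simp: h_def)
    then have "v y < v (y - h)" "v (y - h) \<le> v y" using d(2) y(2) by auto
    then show False by simp
  qed
  with y(2)[OF t] show ?thesis by simp
qed

text \<open>Reversing time and changing the sign of \<open>v\<close> preserves the sign of the
  derivative and swaps the ends, so this is \<open>barrier_above\<close> started from
  \<open>b\<close>.\<close>

lemma barrier_below:
  fixes v :: "real \<Rightarrow> real"
  assumes v: "\<And>t. t \<in> {a..b} \<Longrightarrow> (v has_real_derivative v' t) (at t within {a..b})"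
    and "end": "- N \<le> v b"
    and neg: "\<And>t. t \<in> {a..b} \<Longrightarrow> v t < - N \<Longrightarrow> v' t < 0"
    and t: "t \<in> {a..b}"
  shows "- N \<le> v t"
proof -
  have "- v (- (- t)) \<le> N"
  proof (rule barrier_above[where v="\<lambda>t. - v (- t)" and v'="\<lambda>t. v' (- t)" and a="- b" and b="- a"])
    fix r assume r: "r \<in> {- b..- a}"
    have im: "uminus ` {- b..- a} = {a..b}" by (simp add: image_uminus_atLeastAtMost)
    have "(v has_real_derivative v' (- r)) (at (- r) within uminus ` {- b..- a})"
      unfolding im using r by (intro v) auto
    then have "((v \<circ> uminus) has_real_derivative v' (- r) * (- 1)) (at r within {- b..- a})"
      by (rule DERIV_image_chain) (auto intro!: derivative_eq_intros)
    then show "((\<lambda>t. - v (- t)) has_real_derivative v' (- r)) (at r within {- b..- a})"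
      by (auto intro!: derivative_eq_intros simp: o_def dest: DERIV_minus)
  qed (use assms in auto)
  then show ?thesis by simp
qed

section \<open>Elementary bounds, cut-offs and exhaustion by compact intervals\<close>

lemma exp_diff_le: "exp x - exp y \<le> exp x * (x - y)" for x y :: real
proof -
  have "exp x * (1 + (y - x)) \<le> exp x * exp (y - x)"
    by (intro mult_left_mono exp_ge_add_one_self) auto
  then show ?thesis by (simp add: exp_add[symmetric] algebra_simps)
qed

lemma compact_continuous_abs_bound:
  fixes g :: "real \<Rightarrow> real"
  assumes "continuous_on {a..b} g"
  obtains c where "c \<ge> 0" "\<And>t. t \<in> {a..b} \<Longrightarrow> \<bar>g t\<bar> \<le> c"
proof -
  have "bounded (g ` {a..b})" using assms by (intro compact_imp_bounded compact_continuous_image) auto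
  then obtain c where "\<forall>x\<in>{a..b}. \<bar>g x\<bar> \<le> c" by (auto simp: bounded_iff)
  then show thesis by (intro that[of "max c 0"]) force+
qed

text \<open>The cut-off for \<open>u\<close> and \<open>u'\<close>. For \<open>l \<le> h\<close> it
  is the nearest-point retraction onto \<open>[l, h]\<close>: it preserves Lipschitz bounds and does
  not affect solutions that stay in this range.\<close>

definition clip :: "real \<Rightarrow> real \<Rightarrow> real \<Rightarrow> real" where
  "clip l h x = max l (min h x)"

lemma clip_diff_le: "\<bar>clip l h x - clip l h y\<bar> \<le> \<bar>x - y\<bar>"
  by (auto simp: clip_def)

lemma clip_in: "l \<le> h \<Longrightarrow> clip l h x \<in> {l..h}"
  by (auto simp: clip_def)

lemma clip_id: "x \<in> {l..h} \<Longrightarrow> clip l h x = x"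
  by (auto simp: clip_def)

text \<open>Two layers of width \<open>e\<close> are reserved on each side: the outer one keeps a
  weight function away from zero, the inner one leaves room for the mean value theorem.\<close>

lemma interval_enlarge:
  fixes E :: "real set"
  assumes "open E" "is_interval E" "c \<in> E" "d \<in> E"
  obtains e where "e > 0" "{c - 2 * e..d + 2 * e} \<subseteq> E"
proof -
  obtain e1 e2 where e: "e1 > 0" "cball c e1 \<subseteq> E" "e2 > 0" "cball d e2 \<subseteq> E"
    using assms by (meson open_contains_cball)
  define e where "e = min e1 e2 / 2"
  have "c - 2 * e \<in> cball c e1" "d + 2 * e \<in> cball d e2"
    using e(1,3) by (auto simp: e_def dist_real_def)
  then have "c - 2 * e \<in> E" "d + 2 * e \<in> E" using e(2,4) by auto
  then have "{c - 2 * e..d + 2 * e} \<subseteq> E"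
    using mem_is_interval_1_I[OF assms(2)] by (meson atLeastAtMost_iff subsetI)
  moreover have "e > 0" using e(1,3) by (simp add: e_def)
  ultimately show thesis using that by blast
qed

lemma interval_exhaustion:
  fixes E :: "real set"
  assumes E: "open E" "is_interval E" "E \<noteq> {}"
  obtains \<alpha> \<beta> :: "nat \<Rightarrow> real" where "\<And>n. \<alpha> n < \<beta> n" "\<And>n. {\<alpha> n..\<beta> n} \<subseteq> E"
    "\<And>K. compact K \<Longrightarrow> K \<subseteq> E \<Longrightarrow> \<exists>N. \<forall>n\<ge>N. K \<subseteq> {\<alpha> n..\<beta> n}"
proof -
  obtain y0 where y0: "y0 \<in> E" using E by auto
  obtain K where K: "\<And>n. compact (K n)" "\<And>n. K n \<subseteq> E"
    "\<And>n. K n \<subseteq> interior (K (Suc n))" "\<Union> (range K) = E"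
    "\<And>S. compact S \<Longrightarrow> S \<subseteq> E \<Longrightarrow> \<exists>N. \<forall>n\<ge>N. S \<subseteq> K n"
    by (rule open_Union_compact_subsets[OF E(1)]) (rule that)
  have "\<exists>a b. a < b \<and> {a..b} \<subseteq> E \<and> K n \<subseteq> {a..b}" for n
  proof -
    \<comment> \<open>The added point makes the set nonempty even if \<open>K n\<close> is empty;
      the enlargement by \<open>e\<close> makes the two endpoints distinct.\<close>
    let ?S = "insert y0 (K n)"
    have S: "compact ?S" "?S \<noteq> {}" "?S \<subseteq> E" using K y0 by auto
    obtain a where a: "a \<in> ?S" "\<And>t. t \<in> ?S \<Longrightarrow> a \<le> t" using compact_attains_inf[OF S(1,2)] by blast
    obtain b where b: "b \<in> ?S" "\<And>t. t \<in> ?S \<Longrightarrow> t \<le> b" using compact_attains_sup[OF S(1,2)] by blast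
    obtain e where e: "e > 0" "{a - 2 * e..b + 2 * e} \<subseteq> E"
      using interval_enlarge[OF E(1,2), of a b] a(1) b(1) S(3) by blast
    have "a \<le> b" using a(2) b(1) by blast
    then have "a - 2 * e < b + 2 * e" using e(1) by simp
    moreover have "K n \<subseteq> {a - 2 * e..b + 2 * e}"
    proof
      fix t assume "t \<in> K n"
      then have "a \<le> t" "t \<le> b" using a(2) b(2) by auto
      then show "t \<in> {a - 2 * e..b + 2 * e}" using e(1) by simp
    qed
    ultimately show ?thesis using e(2) by blast
  qed
  then obtain \<alpha> \<beta> where ab: "\<And>n. \<alpha> n < \<beta> n" "\<And>n. {\<alpha> n..\<beta> n} \<subseteq> E" "\<And>n. K n \<subseteq> {\<alpha> n..\<beta> n}"
    by metis
  show thesis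
  proof (rule that[OF ab(1,2)])
    fix S assume "compact S" "S \<subseteq> E"
    then obtain N where "\<forall>n\<ge>N. S \<subseteq> K n" using K(5) by blast
    then show "\<exists>N. \<forall>n\<ge>N. S \<subseteq> {\<alpha> n..\<beta> n}" using ab(3) by blast
  qed
qed

section \<open>A logarithmic Riccati equation\<close>

text \<open>The logarithmic equation reduced to the features that drive the estimates:
  \<open>q \<ge> q0 > 0\<close> controls slopes, \<open>P \<ge> C * B\<close> makes large constants
  supersolutions, and \<open>B > 0\<close> keeps solutions from becoming too negative.\<close>

locale riccati_ode =
  fixes E :: "real set" and q A P B :: "real \<Rightarrow> real" and k q0 C :: real
  assumes E: "open E" "is_interval E"
    and cont: "continuous_on E q" "continuous_on E A" "continuous_on E P" "continuous_on E B"
    and q_ge: "\<And>t. t \<in> E \<Longrightarrow> q t \<ge> q0" and q0: "q0 > 0"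
    and B_pos: "\<And>t. t \<in> E \<Longrightarrow> B t > 0"
    and P_ge: "\<And>t. t \<in> E \<Longrightarrow> P t \<ge> C * B t" and C: "C > 0"
    and k: "k > 0"
begin

definition rhs :: "real \<Rightarrow> real \<Rightarrow> real \<Rightarrow> real" where
  "rhs t u v = - q t * v\<^sup>2 - A t * v + P t - B t * exp (- k * u)"

definition solves :: "(real \<Rightarrow> real) \<Rightarrow> (real \<Rightarrow> real) \<Rightarrow> real set \<Rightarrow> bool" where
  "solves u v S \<longleftrightarrow> (\<forall>t\<in>S. (u has_real_derivative v t) (at t within S) \<and>
     (v has_real_derivative rhs t (u t) (v t)) (at t within S))"

section \<open>Bounds for the coefficients and the right-hand side\<close>

lemma solvesD:
  assumes "solves u v S" "t \<in> S"
  shows "(u has_real_derivative v t) (at t within S)"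
    "(v has_real_derivative rhs t (u t) (v t)) (at t within S)"
  using assms by (auto simp: solves_def)

lemma solves_subset: "solves u v S \<Longrightarrow> T \<subseteq> S \<Longrightarrow> solves u v T"
  unfolding solves_def by (meson DERIV_subset subsetD)

text \<open>One constant serves all estimates on \<open>[a, b]\<close>. The last bound comes from
  the continuous quotient \<open>P / B\<close> and makes very negative constants
  subsolutions.\<close>

lemma coefficient_bound:
  assumes "{a..b} \<subseteq> E"
  obtains c where "c > 0" "\<And>t. t \<in> {a..b} \<Longrightarrow> \<bar>q t\<bar> \<le> c \<and> \<bar>A t\<bar> \<le> c \<and> \<bar>P t\<bar> \<le> c \<and> \<bar>B t\<bar> \<le> c \<and> P t \<le> c * B t"
proof -
  have nz: "B t \<noteq> 0" if "t \<in> {a..b}" for t using B_pos[of t] that assms by auto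
  obtain c1 where c1: "c1 \<ge> 0" "\<And>t. t \<in> {a..b} \<Longrightarrow> \<bar>q t\<bar> \<le> c1"
    using compact_continuous_abs_bound continuous_on_subset[OF cont(1) assms] by metis
  obtain c2 where c2: "c2 \<ge> 0" "\<And>t. t \<in> {a..b} \<Longrightarrow> \<bar>A t\<bar> \<le> c2"
    using compact_continuous_abs_bound continuous_on_subset[OF cont(2) assms] by metis
  obtain c3 where c3: "c3 \<ge> 0" "\<And>t. t \<in> {a..b} \<Longrightarrow> \<bar>P t\<bar> \<le> c3"
    using compact_continuous_abs_bound continuous_on_subset[OF cont(3) assms] by metis
  obtain c4 where c4: "c4 \<ge> 0" "\<And>t. t \<in> {a..b} \<Longrightarrow> \<bar>B t\<bar> \<le> c4"
    using compact_continuous_abs_bound continuous_on_subset[OF cont(4) assms] by metis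
  have "continuous_on {a..b} (\<lambda>t. P t / B t)"
    using nz by (intro continuous_intros continuous_on_subset[OF cont(3) assms] continuous_on_subset[OF cont(4) assms]) auto
  then obtain c5 where c5: "c5 \<ge> 0" "\<And>t. t \<in> {a..b} \<Longrightarrow> \<bar>P t / B t\<bar> \<le> c5"
    using compact_continuous_abs_bound by blast
  show thesis
  proof (rule that[of "c1 + c2 + c3 + c4 + c5 + 1"])
    fix t assume t: "t \<in> {a..b}"
    have Bt: "B t > 0" using t assms B_pos by auto
    have "P t / B t \<le> c1 + c2 + c3 + c4 + c5 + 1" using c5(2)[OF t] c1 c2 c3 c4 by linarith
    then have "P t \<le> (c1 + c2 + c3 + c4 + c5 + 1) * B t"
      using Bt by (simp add: pos_divide_le_eq)
    moreover have "\<bar>q t\<bar> \<le> c1" "\<bar>A t\<bar> \<le> c2" "\<bar>P t\<bar> \<le> c3" "\<bar>B t\<bar> \<le> c4"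
      using t c1(2) c2(2) c3(2) c4(2) by auto
    ultimately show "\<bar>q t\<bar> \<le> c1 + c2 + c3 + c4 + c5 + 1 \<and> \<bar>A t\<bar> \<le> c1 + c2 + c3 + c4 + c5 + 1 \<and>
       \<bar>P t\<bar> \<le> c1 + c2 + c3 + c4 + c5 + 1 \<and> \<bar>B t\<bar> \<le> c1 + c2 + c3 + c4 + c5 + 1 \<and>
       P t \<le> (c1 + c2 + c3 + c4 + c5 + 1) * B t"
      using c1(1) c2(1) c3(1) c4(1) c5(1) by linarith
  qed (use c1 c2 c3 c4 c5 in auto)
qed

text \<open>On the side of \<open>u\<close> a lower bound is enough, since
  \<open>exp (- k * u)\<close> is convex and decreasing, hence Lipschitz to the right of
  \<open>m\<close>; the quadratic term calls for the bound on the slope.\<close>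

lemma rhs_lipschitz:
  assumes ab: "{a..b} \<subseteq> E"
  obtains L where "L \<ge> 0" "\<And>t u u' v v'. t \<in> {a..b} \<Longrightarrow> m \<le> u \<Longrightarrow> m \<le> u' \<Longrightarrow> \<bar>v\<bar> \<le> N \<Longrightarrow> \<bar>v'\<bar> \<le> N \<Longrightarrow>
      \<bar>rhs t u v - rhs t u' v'\<bar> \<le> L * (\<bar>u - u'\<bar> + \<bar>v - v'\<bar>)"
proof -
  obtain c where c: "c > 0" "\<And>t. t \<in> {a..b} \<Longrightarrow> \<bar>q t\<bar> \<le> c \<and> \<bar>A t\<bar> \<le> c \<and> \<bar>P t\<bar> \<le> c \<and> \<bar>B t\<bar> \<le> c \<and> P t \<le> c * B t"
    using coefficient_bound[OF ab] by metis
  define L where "L = c * (2 * \<bar>N\<bar> + 1) + c * (exp (- k * m) * k)"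
  have expd: "exp (- k * u) - exp (- k * u') \<le> exp (- k * m) * k * \<bar>u - u'\<bar>" if "m \<le> u" for u u'
  proof -
    have "exp (- k * u) - exp (- k * u') \<le> exp (- k * u) * (- k * u - (- k * u'))"
      by (rule exp_diff_le)
    also have "\<dots> \<le> exp (- k * u) * (k * \<bar>u - u'\<bar>)"
    proof (intro mult_left_mono)
      have "k * (u' - u) \<le> k * \<bar>u - u'\<bar>" using k by (intro mult_left_mono) auto
      then show "- k * u - (- k * u') \<le> k * \<bar>u - u'\<bar>" by (simp add: algebra_simps)
    qed auto
    also have "\<dots> \<le> exp (- k * m) * (k * \<bar>u - u'\<bar>)"
      using that k by (intro mult_right_mono) auto
    finally show ?thesis by (simp add: mult.assoc)
  qed
  show thesis
  proof (rule that[of L])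
    show "L \<ge> 0" using c(1) k by (simp add: L_def)
    fix t u u' v v' assume t: "t \<in> {a..b}" and u: "m \<le> u" "m \<le> u'" and v: "\<bar>v\<bar> \<le> N" "\<bar>v'\<bar> \<le> N"
    have "rhs t u v - rhs t u' v' = - q t * ((v + v') * (v - v')) - A t * (v - v')
        - B t * (exp (- k * u) - exp (- k * u'))"
      by (simp add: rhs_def algebra_simps power2_eq_square)
    then have "\<bar>rhs t u v - rhs t u' v'\<bar> \<le> \<bar>q t\<bar> * (\<bar>v + v'\<bar> * \<bar>v - v'\<bar>) + \<bar>A t\<bar> * \<bar>v - v'\<bar>
        + \<bar>B t\<bar> * \<bar>exp (- k * u) - exp (- k * u')\<bar>"
      by (simp add: abs_mult[symmetric])
    also have "\<dots> \<le> c * ((2 * \<bar>N\<bar>) * \<bar>v - v'\<bar>) + c * \<bar>v - v'\<bar> + c * (exp (- k * m) * k * \<bar>u - u'\<bar>)"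
    proof (intro add_mono mult_mono)
      show "\<bar>exp (- k * u) - exp (- k * u')\<bar> \<le> exp (- k * m) * k * \<bar>u - u'\<bar>"
        using expd[of u u'] expd[of u' u] u by (simp add: abs_minus_commute abs_le_iff)
    qed (use c t v in auto)
    also have "\<dots> \<le> L * (\<bar>u - u'\<bar> + \<bar>v - v'\<bar>)"
    proof -
      have "0 \<le> c * (2 * \<bar>N\<bar> + 1) * \<bar>u - u'\<bar>" "0 \<le> c * (exp (- k * m) * k) * \<bar>v - v'\<bar>"
        using c(1) k by auto
      then show ?thesis by (simp add: L_def algebra_simps)
    qed
    finally show "\<bar>rhs t u v - rhs t u' v'\<bar> \<le> L * (\<bar>u - u'\<bar> + \<bar>v - v'\<bar>)" .
  qed
qed

text \<open>Clipping does not increase distances, so the Lipschitz bound on a box becomes a global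
  one.\<close>

lemma clipped_lipschitz:
  assumes ab: "{a..b} \<subseteq> E" and mM: "m \<le> M" and N: "N \<ge> 0"
  obtains L where "\<And>t x y. t \<in> {a..b} \<Longrightarrow>
      \<bar>rhs t (clip m M (fst x)) (clip (- N) N (snd x)) - rhs t (clip m M (fst y)) (clip (- N) N (snd y))\<bar>
        \<le> L * norm (x - y)"
proof -
  obtain L where L: "L \<ge> 0" "\<And>t u u' v v'. t \<in> {a..b} \<Longrightarrow> m \<le> u \<Longrightarrow> m \<le> u' \<Longrightarrow> \<bar>v\<bar> \<le> N \<Longrightarrow> \<bar>v'\<bar> \<le> N \<Longrightarrow>
      \<bar>rhs t u v - rhs t u' v'\<bar> \<le> L * (\<bar>u - u'\<bar> + \<bar>v - v'\<bar>)"
    using rhs_lipschitz[OF ab, of m N] by metis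
  show thesis
  proof (rule that[of "L * 2"])
    fix t and x y :: "real \<times> real" assume t: "t \<in> {a..b}"
    have cl: "m \<le> clip m M z" "\<bar>clip (- N) N z\<bar> \<le> N" for z
      using clip_in[OF mM, of z] clip_in[of "- N" N z] N by auto
    have "\<bar>rhs t (clip m M (fst x)) (clip (- N) N (snd x)) - rhs t (clip m M (fst y)) (clip (- N) N (snd y))\<bar>
       \<le> L * (\<bar>clip m M (fst x) - clip m M (fst y)\<bar> + \<bar>clip (- N) N (snd x) - clip (- N) N (snd y)\<bar>)"
      by (intro L(2) t cl)
    also have "\<dots> \<le> L * (\<bar>fst (x - y)\<bar> + \<bar>snd (x - y)\<bar>)"
      using L(1) by (intro mult_left_mono add_mono) (auto simp: clip_diff_le)
    also have "\<dots> \<le> L * (norm (x - y) + norm (x - y))"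
      using L(1) norm_fst_le[of "fst (x - y)" "snd (x - y)"] norm_snd_le[of "snd (x - y)" "fst (x - y)"]
      by (intro mult_left_mono add_mono) (auto simp: minus_prod_def)
    finally show "\<bar>rhs t (clip m M (fst x)) (clip (- N) N (snd x)) - rhs t (clip m M (fst y)) (clip (- N) N (snd y))\<bar>
        \<le> L * 2 * norm (x - y)" by (simp add: mult.assoc)
  qed
qed

text \<open>Uniform in \<open>u\<close>, because the only term containing \<open>u\<close> is negative.\<close>

lemma rhs_neg_large_slope:
  assumes ab: "{a..b} \<subseteq> E"
  obtains N where "N > 0" "\<And>t u v. t \<in> {a..b} \<Longrightarrow> \<bar>v\<bar> \<ge> N \<Longrightarrow> rhs t u v < 0"
proof -
  obtain c where c: "c > 0" "\<And>t. t \<in> {a..b} \<Longrightarrow> \<bar>q t\<bar> \<le> c \<and> \<bar>A t\<bar> \<le> c \<and> \<bar>P t\<bar> \<le> c \<and> \<bar>B t\<bar> \<le> c \<and> P t \<le> c * B t"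
    using coefficient_bound[OF ab] by metis
  show thesis
  \<comment> \<open>For such slopes \<open>q0 * v\<^sup>2\<close> exceeds
    \<open>2 * c * \<bar>v\<bar>\<close>; the summand 1 ensures
    \<open>\<bar>v\<bar> \<ge> 1\<close>, so this covers both \<open>A t * v\<close> and
    \<open>P t\<close>.\<close>
  proof (rule that[of "2 * c / q0 + 1"])
    show "2 * c / q0 + 1 > 0" using c q0 by (simp add: add_pos_pos)
    fix t u v assume t: "t \<in> {a..b}" and v: "\<bar>v\<bar> \<ge> 2 * c / q0 + 1"
    have v1: "\<bar>v\<bar> \<ge> 1" using v c(1) q0 by (smt (verit) divide_nonneg_pos)
    have "q0 * \<bar>v\<bar> \<ge> q0 * (2 * c / q0 + 1)" using v q0 by (intro mult_left_mono) auto
    then have "q0 * \<bar>v\<bar> > 2 * c" using q0 by (simp add: algebra_simps)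
    then have "q0 * \<bar>v\<bar> * \<bar>v\<bar> > 2 * c * \<bar>v\<bar>" using v1 by (intro mult_strict_right_mono) auto
    moreover have "c * \<bar>v\<bar> \<ge> c" using v1 c(1) by simp
    moreover have "q t * v\<^sup>2 \<ge> q0 * \<bar>v\<bar> * \<bar>v\<bar>"
      using q_ge[of t] t ab mult_right_mono[of q0 "q t" "v\<^sup>2"] by (auto simp: power2_eq_square)
    moreover have "\<bar>A t * v\<bar> \<le> c * \<bar>v\<bar>" using c(2)[OF t] by (simp add: abs_mult mult_right_mono)
    moreover have "P t \<le> c" using c(2)[OF t] by auto
    moreover have "B t * exp (- k * u) > 0" using B_pos t ab by auto
    ultimately show "rhs t u v < 0" unfolding rhs_def by (simp add: abs_le_iff)
  qed
qed

section \<open>Solutions on compact intervals between constant barriers\<close>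

text \<open>The solution takes the value \<open>M\<close> at both ends, which fixes the sign of the
  slope there and so starts the slope barriers. The lower bound found on the way depends on the
  interval, so only the uniform bound \<open>M\<close> is passed on.\<close>

lemma bvp_solution:
  assumes ab: "a < b" "{a..b} \<subseteq> E" and M: "exp (- k * M) < C"
  obtains u v where "solves u v {a..b}" "\<And>t. t \<in> {a..b} \<Longrightarrow> u t \<le> M"
proof -
  obtain c where c: "c > 0" "\<And>t. t \<in> {a..b} \<Longrightarrow> \<bar>q t\<bar> \<le> c \<and> \<bar>A t\<bar> \<le> c \<and> \<bar>P t\<bar> \<le> c \<and> \<bar>B t\<bar> \<le> c \<and> P t \<le> c * B t"
    using coefficient_bound[OF ab(2)] by metis
  obtain N where N: "N > 0" "\<And>t u v. t \<in> {a..b} \<Longrightarrow> \<bar>v\<bar> \<ge> N \<Longrightarrow> rhs t u v < 0"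
    using rhs_neg_large_slope[OF ab(2)] by metis
  have B: "B t > 0" if "t \<in> {a..b}" for t using that ab B_pos by auto
  \<comment> \<open>Chosen so that \<open>exp (- k * m) \<ge> c + 1\<close>, which beats
    \<open>P t \<le> c * B t\<close>; the minimum with \<open>M\<close> puts the boundary values
    above \<open>m\<close>.\<close>
  define m where "m = min M (- ln (c + 1) / k)"
  have mM: "m \<le> M" by (simp add: m_def)
  have "k * m \<le> - ln (c + 1)"
    using mult_left_mono[of m "- ln (c + 1) / k" k] k by (simp add: m_def)
  then have "exp (ln (c + 1)) \<le> exp (- k * m)" by simp
  then have m: "exp (- k * m) > c" using c(1) by simp
  have rhs_m: "rhs t m 0 < 0" if "t \<in> {a..b}" for t
  proof -
    have "P t \<le> c * B t" using c(2)[OF that] by auto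
    also have "\<dots> < exp (- k * m) * B t" using m B[OF that] by (intro mult_strict_right_mono)
    finally show ?thesis by (simp add: rhs_def mult.commute)
  qed
  have rhs_M: "rhs t M 0 > 0" if "t \<in> {a..b}" for t
  proof -
    have "exp (- k * M) * B t < C * B t" using M B[OF that] by (intro mult_strict_right_mono)
    also have "\<dots> \<le> P t" using P_ge that ab by auto
    finally show ?thesis by (simp add: rhs_def mult.commute)
  qed
  define F where "F t x y = rhs t (clip m M x) (clip (- N) N y)" for t x y
  have clN: "\<bar>clip (- N) N y\<bar> \<le> N" for y using clip_in[of "- N" N y] N by auto
  have F_cont: "continuous_on ({a..b} \<times> UNIV) (\<lambda>(t, x). F t (fst x) (snd x))"
  proof -
    have coef: "continuous_on ({a..b} \<times> UNIV) (\<lambda>x. g (fst x))" if "continuous_on E g" for g :: "real \<Rightarrow> real"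
      using ab by (intro continuous_on_compose2[OF that] continuous_intros) auto
    show ?thesis
      unfolding F_def rhs_def clip_def case_prod_beta
      by (intro continuous_intros coef cont)
  qed
  obtain L where L: "\<And>t x y. t \<in> {a..b} \<Longrightarrow>
      \<bar>F t (fst x) (snd x) - F t (fst y) (snd y)\<bar> \<le> L * norm (x - y)"
    using clipped_lipschitz[OF ab(2) mM, of N] N unfolding F_def by (metis less_imp_le)
  have F_bnd: "\<bar>F t x y\<bar> \<le> c * N\<^sup>2 + c * N + c + c * exp (- k * m)" if t: "t \<in> {a..b}" for t x y
  proof -
    let ?v = "clip (- N) N y" and ?e = "exp (- k * clip m M x)"
    have "\<bar>F t x y\<bar> \<le> \<bar>q t\<bar> * \<bar>?v\<bar>\<^sup>2 + \<bar>A t\<bar> * \<bar>?v\<bar> + \<bar>P t\<bar> + \<bar>B t\<bar> * ?e"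
    proof -
      have "\<bar>w - x + y - z\<bar> \<le> \<bar>w\<bar> + \<bar>x\<bar> + \<bar>y\<bar> + \<bar>z\<bar>" for w x y z :: real by linarith
      from this[of "- q t * ?v\<^sup>2" "A t * ?v" "P t" "B t * ?e"] show ?thesis
        by (simp add: F_def rhs_def abs_mult)
    qed
    also have "\<dots> \<le> c * N\<^sup>2 + c * N + c + c * exp (- k * m)"
    proof (intro add_mono mult_mono power_mono)
      show "?e \<le> exp (- k * m)" using clip_in[OF mM, of x] k by auto
    qed (use c(2)[OF t] c(1) clN N in auto)
    finally show ?thesis .
  qed
  obtain u v where uv: "u a = M" "u b = M"
    "\<And>t. t \<in> {a..b} \<Longrightarrow> (u has_real_derivative v t) (at t within {a..b})"
    "\<And>t. t \<in> {a..b} \<Longrightarrow> (v has_real_derivative F t (u t) (v t)) (at t within {a..b})"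
    using bounded_lipschitz_bvp[OF ab(1) F_cont L F_bnd] by metis
  have u_cont: "continuous_on {a..b} u" using uv(3) by (rule DERIV_continuous_on)
  \<comment> \<open>At an interior maximum above \<open>M\<close> the slope vanishes and the cut-off
    replaces \<open>u\<close> by \<open>M\<close>, so the second derivative is
    \<open>rhs y M 0 > 0\<close>, a contradiction. The lower bound is the mirror image with
    \<open>m\<close>.\<close>
  have le_M: "u t \<le> M" if t: "t \<in> {a..b}" for t
  proof -
    obtain y where y: "y \<in> {a..b}" "\<And>t. t \<in> {a..b} \<Longrightarrow> u t \<le> u y"
      using continuous_attains_sup[of "{a..b}" u] u_cont ab by auto
    have "u y \<le> M"
    proof (rule ccontr)
      assume *: "\<not> u y \<le> M"
      then have y': "a < y" "y < b" using y(1) uv(1,2) by (auto simp: le_less)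
      from interior_max_second_derivative[OF y' y(2) uv(3) uv(4)[OF y(1)]]
      have "v y = 0" "F y (u y) (v y) \<le> 0" by auto
      moreover have "clip m M (u y) = M" using * mM by (auto simp: clip_def)
      ultimately show False using rhs_M[OF y(1)] N by (simp add: F_def clip_id)
    qed
    then show ?thesis using y(2)[OF t] by simp
  qed
  have ge_m: "m \<le> u t" if t: "t \<in> {a..b}" for t
  proof -
    obtain y where y: "y \<in> {a..b}" "\<And>t. t \<in> {a..b} \<Longrightarrow> u y \<le> u t"
      using continuous_attains_inf[of "{a..b}" u] u_cont ab by auto
    have "m \<le> u y"
    proof (rule ccontr)
      assume *: "\<not> m \<le> u y"
      then have y': "a < y" "y < b" using y(1) uv(1,2) mM by (auto simp: le_less)
      have "- v y = 0" "- F y (u y) (v y) \<le> 0"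
        using interior_max_second_derivative[OF y', of "\<lambda>t. - u t" "\<lambda>t. - v t" "- F y (u y) (v y)"]
          y(2) uv(3) uv(4)[OF y(1)] by (auto intro: DERIV_minus)
      moreover have "clip m M (u y) = m" using * mM by (auto simp: clip_def)
      ultimately show False using rhs_m[OF y(1)] N by (simp add: F_def clip_id)
    qed
    then show ?thesis using y(2)[OF t] by simp
  qed
  \<comment> \<open>A slope beyond \<open>N\<close> is clipped to absolute value exactly
    \<open>N\<close>, where the right-hand side is already negative.\<close>
  have F_neg: "F t x y < 0" if "t \<in> {a..b}" "\<bar>y\<bar> > N" for t x y
    unfolding F_def using that N by (intro N(2)) (auto simp: clip_def)
  \<comment> \<open>As \<open>u\<close> starts at its upper bound \<open>M\<close>, its initial
    slope cannot be positive; the same reasoning at \<open>b\<close> gives the opposite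
    sign.\<close>
  have v_a: "v a \<le> 0"
  proof (rule ccontr)
    assume "\<not> v a \<le> 0"
    then have "v a > 0" by simp
    from has_real_derivative_pos_inc_right[OF uv(3)[of a] this] ab(1)
    obtain d where d: "d > 0" "\<And>h. h > 0 \<Longrightarrow> a + h \<in> {a..b} \<Longrightarrow> h < d \<Longrightarrow> u a < u (a + h)" by auto
    define h where "h = min (d / 2) (b - a)"
    have "h > 0" "h < d" "a + h \<in> {a..b}" using d(1) ab(1) by (auto simp: h_def)
    then show False using d(2)[of h] le_M[of "a + h"] uv(1) by simp
  qed
  have v_b: "v b \<ge> 0"
  proof (rule ccontr)
    assume "\<not> v b \<ge> 0"
    then have "v b < 0" by simp
    from has_real_derivative_neg_dec_left[OF uv(3)[of b] this] ab(1)
    obtain d where d: "d > 0" "\<And>h. h > 0 \<Longrightarrow> b - h \<in> {a..b} \<Longrightarrow> h < d \<Longrightarrow> u b < u (b - h)" by auto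
    define h where "h = min (d / 2) (b - a)"
    have "h > 0" "h < d" "b - h \<in> {a..b}" using d(1) ab(1) by (auto simp: h_def)
    then show False using d(2)[of h] le_M[of "b - h"] uv(2) by simp
  qed
  \<comment> \<open>The slope decreases wherever it is large in absolute value: an upper bound
    spreads to the right from \<open>a\<close>, a lower bound to the left from
    \<open>b\<close>.\<close>
  have "v t \<le> N" if "t \<in> {a..b}" for t
    by (rule barrier_above[OF uv(4) _ _ that]) (use v_a N(1) F_neg in auto)
  moreover have "- N \<le> v t" if "t \<in> {a..b}" for t
    by (rule barrier_below[OF uv(4) _ _ that]) (use v_b N(1) F_neg in auto)
  ultimately have "F t (u t) (v t) = rhs t (u t) (v t)" if "t \<in> {a..b}" for t
    using that le_M ge_m by (simp add: F_def clip_id)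
  then have "solves u v {a..b}"
    using uv(3,4) by (simp add: solves_def)
  then show thesis using le_M by (rule that)
qed

section \<open>Interior estimates uniform over all solutions\<close>

text \<open>The weight vanishes at the ends, so the maximum is interior whatever the boundary values
  of \<open>u\<close>. There the second-order condition, multiplied by the squared weight, bounds
  \<open>B\<close> times the square of the weighted quantity; hence the exponent
  \<open>k * u / 2\<close> rather than \<open>k * u\<close>.\<close>

lemma interior_lower_bound:
  assumes ab: "a < b" "{a..b} \<subseteq> E"
  obtains H where "H > 0" "\<And>u v t. solves u v {a..b} \<Longrightarrow> t \<in> {a..b} \<Longrightarrow>
    (t - a) * (b - t) * exp (- k * u t / 2) \<le> H"
proof -
  obtain c where c: "c > 0" "\<And>t. t \<in> {a..b} \<Longrightarrow> \<bar>q t\<bar> \<le> c \<and> \<bar>A t\<bar> \<le> c \<and> \<bar>P t\<bar> \<le> c \<and> \<bar>B t\<bar> \<le> c \<and> P t \<le> c * B t"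
    using coefficient_bound[OF ab(2)] by metis
  have "\<exists>y\<in>{a..b}. \<forall>t\<in>{a..b}. B y \<le> B t"
    using ab by (intro continuous_attains_inf continuous_on_subset[OF cont(4)]) auto
  then obtain \<beta> where \<beta>: "\<beta> > 0" "\<And>t. t \<in> {a..b} \<Longrightarrow> \<beta> \<le> B t"
    using B_pos ab(2) by blast
  define l where "l = b - a"
  \<comment> \<open>Collects the terms that survive at the maximum point, estimated by
    \<open>\<phi> \<le> l * l\<close>, \<open>\<bar>\<phi>'\<bar> \<le> l\<close> and the
    coefficient bound \<open>c\<close>.\<close>
  define Q where "Q = (2 / k) * (c * l * (l * l)) + c * (l * l * (l * l)) + (2 / k) * (2 * (l * l) + l * l)"
  have l: "l > 0" using ab by (simp add: l_def)
  have Q: "Q > 0" unfolding Q_def using c k l by (intro add_pos_pos mult_pos_pos) auto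
  show thesis
  proof (rule that[of "sqrt (Q / \<beta>)"])
    show "sqrt (Q / \<beta>) > 0" using Q \<beta> by simp
    fix u v t assume sol: "solves u v {a..b}" and t: "t \<in> {a..b}"
    define \<phi> where "\<phi> t = (t - a) * (b - t)" for t
    define \<phi>' where "\<phi>' t = a + b - 2 * t" for t
    define h where "h t = \<phi> t * exp (- k * u t / 2)" for t
    have u_cont: "continuous_on {a..b} u" using solvesD(1)[OF sol] by (rule DERIV_continuous_on)
    have "continuous_on {a..b} h" unfolding h_def \<phi>_def by (intro continuous_intros u_cont) auto
    then obtain y where y: "y \<in> {a..b}" "\<And>t. t \<in> {a..b} \<Longrightarrow> h t \<le> h y"
      using continuous_attains_sup[of "{a..b}" h] ab by auto
    have "h ((a + b) / 2) > 0" unfolding h_def \<phi>_def using ab by (intro mult_pos_pos) (auto simp: field_simps)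
    then have hy: "h y > 0" using y(2)[of "(a + b) / 2"] ab by auto
    have y_ne: "y \<noteq> a" "y \<noteq> b" using hy by (auto simp: h_def \<phi>_def)
    then have y': "a < y" "y < b" using y(1) by auto
    have \<phi>_pos: "\<phi> t > 0" if "a < t" "t < b" for t using that by (simp add: \<phi>_def)
    \<comment> \<open>A smaller interval around \<open>y\<close> on which \<open>\<phi>\<close> is
      positive, so that \<open>w = ln h\<close> is defined and differentiable up to its
      ends.\<close>
    define a' where "a' = (a + y) / 2"
    define b' where "b' = (y + b) / 2"
    have ab': "a < a'" "a' < y" "y < b'" "b' < b" using y' by (auto simp: a'_def b'_def)
    have sol': "solves u v {a'..b'}" by (rule solves_subset[OF sol]) (use ab' in auto)
    define w where "w t = ln (\<phi> t) - k * u t / 2" for t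
    define w' where "w' t = \<phi>' t / \<phi> t - k * v t / 2" for t
    define D where "D = (- 2 * \<phi> y - \<phi>' y * \<phi>' y) / (\<phi> y * \<phi> y) - k * rhs y (u y) (v y) / 2"
    have h_exp: "h t = exp (w t)" if "t \<in> {a'..b'}" for t
    proof -
      have "exp (w t) = exp (ln (\<phi> t)) * exp (- k * u t / 2)"
        unfolding w_def exp_add[symmetric] by simp
      then show ?thesis using \<phi>_pos[of t] that ab' by (simp add: h_def)
    qed
    have w_max: "w t \<le> w y" if "t \<in> {a'..b'}" for t
    proof -
      have "h t \<le> h y" using that ab' by (intro y(2)) auto
      then show ?thesis using h_exp[OF that] h_exp[of y] ab' by auto
    qed
    have d\<phi>: "(\<phi> has_real_derivative \<phi>' t) (at t within S)" for t S
      unfolding \<phi>_def \<phi>'_def by (auto intro!: derivative_eq_intros)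
    have dw: "(w has_real_derivative w' t) (at t within {a'..b'})" if "t \<in> {a'..b'}" for t
      unfolding w_def w'_def using \<phi>_pos[of t] that ab'
      by (auto intro!: derivative_eq_intros d\<phi> solvesD(1)[OF sol'])
    have dw': "(w' has_real_derivative D) (at y within {a'..b'})"
    proof -
      have "(\<phi>' has_real_derivative - 2) (at y within {a'..b'})"
        unfolding \<phi>'_def by (auto intro!: derivative_eq_intros)
      then show ?thesis
        unfolding w'_def D_def using \<phi>_pos[of y] ab'
        by (auto intro!: derivative_eq_intros d\<phi> solvesD(2)[OF sol'])
    qed
    note second = interior_max_second_derivative[OF ab'(2,3) w_max dw dw']
    have \<phi>y: "\<phi> y > 0" using \<phi>_pos y' by blast
    \<comment> \<open>The first-order condition \<open>w' y = 0\<close> says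
      \<open>\<phi> y * v y = (2 / k) * \<phi>' y\<close>: the weighted slope is bounded even though
      \<open>v y\<close> itself is not yet controlled.\<close>
    define V where "V = (2 / k) * \<phi>' y"
    have V: "V = \<phi> y * v y"
      using second(1) \<phi>y k by (simp add: w'_def V_def field_simps)
    define X where "X = exp (- k * u y / 2)"
    have X: "exp (- k * u y) = X * X" by (simp add: X_def exp_add[symmetric])
    have hX: "h y = \<phi> y * X" by (simp add: h_def X_def)
    have \<phi>le: "\<phi> y \<le> l * l" unfolding \<phi>_def l_def using y' by (intro mult_mono) auto
    have \<phi>'le: "\<bar>\<phi>' y\<bar> \<le> l" unfolding \<phi>'_def l_def using y' by auto
    \<comment> \<open>The second-order condition is multiplied by
      \<open>(2 / k) * (\<phi> y)\<^sup>2\<close>. Besides \<open>B y * (h y)\<^sup>2\<close> this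
      leaves bounded terms and \<open>- q y * V\<^sup>2\<close>, which is dropped because of its
      sign.\<close>
    have "(- 2 * \<phi> y - \<phi>' y * \<phi>' y) / (\<phi> y * \<phi> y) \<le> k * rhs y (u y) (v y) / 2"
      using second(2) by (simp add: D_def)
    then have "- 2 * \<phi> y - \<phi>' y * \<phi>' y \<le> k * rhs y (u y) (v y) / 2 * (\<phi> y * \<phi> y)"
      using \<phi>y by (simp add: pos_divide_le_eq)
    then have "(2 / k) * (- 2 * \<phi> y - \<phi>' y * \<phi>' y) \<le> (2 / k) * (k * rhs y (u y) (v y) / 2 * (\<phi> y * \<phi> y))"
      using k by (intro mult_left_mono) auto
    also have "\<dots> = rhs y (u y) (v y) * (\<phi> y * \<phi> y)" using k by simp
    also have "\<dots> = - q y * (V * V) - A y * V * \<phi> y + P y * (\<phi> y * \<phi> y) - B y * (h y * h y)"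
      unfolding rhs_def V hX X by (simp add: algebra_simps power2_eq_square)
    finally have "B y * (h y * h y) \<le> - q y * (V * V) + (- A y * V * \<phi> y) + P y * (\<phi> y * \<phi> y)
        + (2 / k) * (2 * \<phi> y + \<phi>' y * \<phi>' y)"
      by (simp add: algebra_simps)
    also have "\<dots> \<le> 0 + (2 / k) * (c * l * (l * l)) + c * (l * l * (l * l)) + (2 / k) * (2 * (l * l) + l * l)"
    proof (intro add_mono)
      show "- q y * (V * V) \<le> 0"
        using q_ge[of y] q0 y(1) ab(2) by (auto simp: zero_le_mult_iff)
      have "- A y * V * \<phi> y \<le> \<bar>A y\<bar> * \<bar>V\<bar> * \<bar>\<phi> y\<bar>"
        by (metis abs_ge_minus_self abs_mult mult_minus_left)
      also have "\<dots> \<le> c * ((2 / k) * l) * (l * l)"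
        using c(2)[OF y(1)] c(1) \<phi>le \<phi>y \<phi>'le k l
        by (intro mult_mono) (auto simp: V_def abs_mult intro!: divide_right_mono)
      also have "\<dots> = (2 / k) * (c * l * (l * l))" by simp
      finally show "- A y * V * \<phi> y \<le> (2 / k) * (c * l * (l * l))" .
      have "P y * (\<phi> y * \<phi> y) \<le> c * (\<phi> y * \<phi> y)"
        using c(2)[OF y(1)] by (intro mult_right_mono) auto
      also have "\<dots> \<le> c * (l * l * (l * l))"
        using c(1) \<phi>le \<phi>y by (intro mult_left_mono mult_mono) auto
      finally show "P y * (\<phi> y * \<phi> y) \<le> c * (l * l * (l * l))" .
      have "\<phi>' y * \<phi>' y \<le> l * l"
        using mult_mono[OF \<phi>'le \<phi>'le] l by (simp add: abs_mult[symmetric])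
      then show "(2 / k) * (2 * \<phi> y + \<phi>' y * \<phi>' y) \<le> (2 / k) * (2 * (l * l) + l * l)"
        using \<phi>le k by (intro mult_left_mono add_mono) auto
    qed
    also have "\<dots> = Q" by (simp add: Q_def)
    finally have "B y * (h y * h y) \<le> Q" .
    moreover have "\<beta> * (h y * h y) \<le> B y * (h y * h y)"
      using \<beta>(2)[OF y(1)] by (intro mult_right_mono) auto
    ultimately have "(h y)\<^sup>2 \<le> Q / \<beta>"
      using \<beta>(1) by (simp add: power2_eq_square pos_le_divide_eq mult.commute)
    then have "h y \<le> sqrt (Q / \<beta>)" by (rule real_le_rsqrt)
    then show "(t - a) * (b - t) * exp (- k * u t / 2) \<le> sqrt (Q / \<beta>)"
      using y(2)[OF t] by (simp add: h_def \<phi>_def)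
  qed
qed

text \<open>The constants are fixed before the solution, so they apply to a whole sequence of
  approximations.\<close>

lemma interior_bounds:
  assumes cd: "e > 0" "c \<le> d" "{c - 2 * e..d + 2 * e} \<subseteq> E"
  obtains m N where "m \<le> M" "N > 0"
    "\<And>u v t. solves u v {c - 2 * e..d + 2 * e} \<Longrightarrow> \<forall>t\<in>{c - 2 * e..d + 2 * e}. u t \<le> M \<Longrightarrow>
       t \<in> {c..d} \<Longrightarrow> m \<le> u t \<and> \<bar>v t\<bar> \<le> N"
proof -
  have lt: "c - 2 * e < d + 2 * e" using cd by simp
  obtain H where H: "H > 0" "\<And>u v t. solves u v {c - 2 * e..d + 2 * e} \<Longrightarrow> t \<in> {c - 2 * e..d + 2 * e} \<Longrightarrow>
    (t - (c - 2 * e)) * (d + 2 * e - t) * exp (- k * u t / 2) \<le> H"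
    using interior_lower_bound[OF lt cd(3)] by metis
  obtain N0 where N0: "N0 > 0" "\<And>t u v. t \<in> {c - 2 * e..d + 2 * e} \<Longrightarrow> \<bar>v\<bar> \<ge> N0 \<Longrightarrow> rhs t u v < 0"
    using rhs_neg_large_slope[OF cd(3)] by metis
  \<comment> \<open>On \<open>{c - e..d + e}\<close> the weight is at least \<open>e * e\<close>,
    which turns \<open>H\<close> into the lower bound \<open>m\<close>; \<open>(M - m) / e\<close>
    then bounds mean slopes over a layer of width \<open>e\<close>.\<close>
  define m where "m = min M (- (2 / k) * ln (H / (e * e)))"
  define N where "N = max N0 ((M - m) / e)"
  show thesis
  proof (rule that[of m N])
    show "m \<le> M" by (simp add: m_def)
    show "N > 0" using N0 by (simp add: N_def)
    fix u v t
    assume sol: "solves u v {c - 2 * e..d + 2 * e}" and t: "t \<in> {c..d}"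
      and "\<forall>t\<in>{c - 2 * e..d + 2 * e}. u t \<le> M"
    then have le: "u t \<le> M" if "t \<in> {c - 2 * e..d + 2 * e}" for t using that by blast
    have ge: "m \<le> u t" if t: "t \<in> {c - e..d + e}" for t
    proof -
      have "e * e * exp (- k * u t / 2) \<le> (t - (c - 2 * e)) * (d + 2 * e - t) * exp (- k * u t / 2)"
        using t cd by (intro mult_right_mono mult_mono) auto
      also have "\<dots> \<le> H" using t cd by (intro H(2)[OF sol]) auto
      finally have "exp (- k * u t / 2) \<le> H / (e * e)"
        using cd(1) by (simp add: pos_le_divide_eq mult.commute)
      then have "- k * u t / 2 \<le> ln (H / (e * e))"
        using H(1) cd(1) by (simp add: ln_ge_iff)
      then show ?thesis using k unfolding m_def by (simp add: field_simps min_le_iff_disj)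
    qed
    have N_neg: "rhs t (u t) (v t) < 0" if "t \<in> {c - 2 * e..d + 2 * e}" "\<bar>v t\<bar> > N" for t
      using that by (intro N0(2)) (auto simp: N_def)
    \<comment> \<open>Points of controlled slope on both sides of \<open>[c, d]\<close>: the upper
      barrier starts from \<open>\<xi>\<close> on the left, the lower barrier from
      \<open>\<zeta>\<close> on the right.\<close>
    obtain \<xi> where \<xi>: "c - e < \<xi>" "\<xi> < c" "u c - u (c - e) = v \<xi> * (c - (c - e))"
      using mvt_within[of "c - e" c "{c - 2 * e..d + 2 * e}" u v] solvesD[OF sol] cd by auto
    obtain \<zeta> where \<zeta>: "d < \<zeta>" "\<zeta> < d + e" "u (d + e) - u d = v \<zeta> * (d + e - d)"
      using mvt_within[of d "d + e" "{c - 2 * e..d + 2 * e}" u v] solvesD[OF sol] cd by auto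
    have "v \<xi> * e \<le> M - m" using \<xi>(3) ge[of "c - e"] le[of c] cd by auto
    then have v\<xi>: "v \<xi> \<le> N" using cd(1) by (simp add: N_def pos_le_divide_eq le_max_iff_disj)
    have "- v \<zeta> * e \<le> M - m" using \<zeta>(3) ge[of "d + e"] le[of d] cd by auto
    then have "- v \<zeta> \<le> (M - m) / e" using cd(1) by (subst pos_le_divide_eq) auto
    then have v\<zeta>: "- N \<le> v \<zeta>" by (simp add: N_def le_max_iff_disj)
    have sol1: "solves u v {\<xi>..d}" "solves u v {c..\<zeta>}"
      by (rule solves_subset[OF sol], use \<xi> \<zeta> cd in auto)+
    have "v t \<le> N"
      by (rule barrier_above[OF solvesD(2)[OF sol1(1)] v\<xi>]) (use N_neg \<xi> t cd in auto)
    moreover have "- N \<le> v t"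
      by (rule barrier_below[OF solvesD(2)[OF sol1(2)] v\<zeta>]) (use N_neg \<zeta> t cd in auto)
    moreover have "m \<le> u t" using t cd by (intro ge) auto
    ultimately show "m \<le> u t \<and> \<bar>v t\<bar> \<le> N" by auto
  qed
qed

section \<open>Passage to the limit along an exhaustion\<close>

theorem global_solution:
  assumes ne: "E \<noteq> {}"
  obtains u v where "\<And>t. t \<in> E \<Longrightarrow> (u has_real_derivative v t) (at t)"
    "\<And>t. t \<in> E \<Longrightarrow> (v has_real_derivative rhs t (u t) (v t)) (at t)"
proof -
  obtain y0 where y0: "y0 \<in> E" using ne by auto
  \<comment> \<open>With this choice \<open>exp (- k * M) = C / 2\<close>.\<close>
  define M where "M = - ln (C / 2) / k"
  have M: "exp (- k * M) < C" using C k by (simp add: M_def)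
  obtain \<alpha> \<beta> where ab: "\<And>n::nat. \<alpha> n < \<beta> n" "\<And>n. {\<alpha> n..\<beta> n} \<subseteq> E"
    "\<And>K. compact K \<Longrightarrow> K \<subseteq> E \<Longrightarrow> \<exists>N. \<forall>n\<ge>N. K \<subseteq> {\<alpha> n..\<beta> n}"
    using interval_exhaustion[OF E ne] by metis
  have "\<exists>u v. solves u v {\<alpha> n..\<beta> n} \<and> (\<forall>t\<in>{\<alpha> n..\<beta> n}. u t \<le> M)" for n
    using bvp_solution[OF ab(1,2) M] by metis
  then obtain U V where UV: "\<And>n. solves (U n) (V n) {\<alpha> n..\<beta> n}"
    "\<And>n t. t \<in> {\<alpha> n..\<beta> n} \<Longrightarrow> U n t \<le> M" by metis
  \<comment> \<open>The bounds hold for all large \<open>n\<close>, because an enlargement of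
    \<open>[c, d]\<close> eventually lies in the intervals
    \<open>{\<alpha> n..\<beta> n}\<close>.\<close>
  have bounds: "\<exists>m N n0. m \<le> M \<and> N > 0 \<and> (\<forall>n\<ge>n0. solves (U n) (V n) {c..d} \<and>
      (\<forall>t\<in>{c..d}. m \<le> U n t \<and> U n t \<le> M \<and> \<bar>V n t\<bar> \<le> N))"
    if cd: "c \<in> E" "d \<in> E" "c \<le> d" for c d
  proof -
    obtain e where e: "e > 0" "{c - 2 * e..d + 2 * e} \<subseteq> E"
      using interval_enlarge[OF E cd(1,2)] by metis
    obtain m N where mN: "m \<le> M" "N > 0"
      "\<And>u v t. solves u v {c - 2 * e..d + 2 * e} \<Longrightarrow> \<forall>t\<in>{c - 2 * e..d + 2 * e}. u t \<le> M \<Longrightarrow>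
       t \<in> {c..d} \<Longrightarrow> m \<le> u t \<and> \<bar>v t\<bar> \<le> N"
      using interior_bounds[OF e(1) cd(3) e(2), of M] by metis
    obtain n0 where n0: "\<And>n. n \<ge> n0 \<Longrightarrow> {c - 2 * e..d + 2 * e} \<subseteq> {\<alpha> n..\<beta> n}"
      using ab(3)[OF compact_Icc e(2)] by blast
    have "solves (U n) (V n) {c..d} \<and> (\<forall>t\<in>{c..d}. m \<le> U n t \<and> U n t \<le> M \<and> \<bar>V n t\<bar> \<le> N)"
      if n: "n \<ge> n0" for n
    proof -
      have sub: "{c..d} \<subseteq> {c - 2 * e..d + 2 * e}" using e(1) by auto
      have s: "solves (U n) (V n) {c - 2 * e..d + 2 * e}" by (rule solves_subset[OF UV(1) n0[OF n]])
      have le: "U n t \<le> M" if "t \<in> {c - 2 * e..d + 2 * e}" for t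
        using UV(2) n0[OF n] that by blast
      have "m \<le> U n t \<and> U n t \<le> M \<and> \<bar>V n t\<bar> \<le> N" if t: "t \<in> {c..d}" for t
      proof -
        have "m \<le> U n t \<and> \<bar>V n t\<bar> \<le> N" by (rule mN(3)[OF s _ t]) (use le in blast)
        moreover have "U n t \<le> M" by (rule le) (use t sub in blast)
        ultimately show ?thesis by blast
      qed
      then show ?thesis using solves_subset[OF s sub] by blast
    qed
    then show ?thesis using mN(1,2) by blast
  qed
  obtain m N n0 where n0: "m \<le> M" "N > 0" "\<And>n. n \<ge> n0 \<Longrightarrow> m \<le> U n y0 \<and> U n y0 \<le> M \<and> \<bar>V n y0\<bar> \<le> N"
    using bounds[OF y0 y0 order_refl] by auto
  \<comment> \<open>One subsequence, extracted from the values of \<open>(U n, V n)\<close> at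
    \<open>y0\<close> alone, works for every interval, so no diagonal argument is made.\<close>
  have "seq_compact ({m..M} \<times> {- N..N})"
    by (intro compact_imp_seq_compact compact_Times compact_Icc)
  moreover have "\<forall>n. (U (n0 + n) y0, V (n0 + n) y0) \<in> {m..M} \<times> {- N..N}"
  proof
    fix n show "(U (n0 + n) y0, V (n0 + n) y0) \<in> {m..M} \<times> {- N..N}"
      using n0(3)[of "n0 + n"] by (auto simp: abs_le_iff)
  qed
  ultimately obtain l r where r: "strict_mono (r :: nat \<Rightarrow> nat)"
    "((\<lambda>n. (U (n0 + n) y0, V (n0 + n) y0)) \<circ> r) \<longlonglongrightarrow> l"
    by (rule seq_compactE)
  define i where "i n = n0 + r n" for n
  have i_ge: "i n \<ge> n" for n using seq_suble[OF r(1), of n] by (simp add: i_def)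
  have lim: "(\<lambda>n. (U (i n) y0, V (i n) y0)) \<longlonglongrightarrow> l"
    using r(2) by (simp add: o_def i_def)
  \<comment> \<open>Taking the limits pointwise once for all \<open>t\<close> avoids gluing
    solutions from different intervals; their existence is established inside
    \<open>sol\<close>.\<close>
  define u where "u t = Topological_Spaces.lim (\<lambda>n. U (i n) t)" for t
  define v where "v t = Topological_Spaces.lim (\<lambda>n. V (i n) t)" for t
  have sol: "solves u v {c..d}" if cd: "c \<in> E" "d \<in> E" "c \<le> y0" "y0 \<le> d" for c d
  proof -
    have cd_E: "{c..d} \<subseteq> E" using mem_is_interval_1_I[OF E(2) cd(1,2)] by auto
    obtain m N n1 where n1: "m \<le> M" "N > 0" "\<And>n. n \<ge> n1 \<Longrightarrow> solves (U n) (V n) {c..d}"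
      "\<And>n t. n \<ge> n1 \<Longrightarrow> t \<in> {c..d} \<Longrightarrow> m \<le> U n t \<and> U n t \<le> M \<and> \<bar>V n t\<bar> \<le> N"
      using bounds[OF cd(1,2) order_trans[OF cd(3,4)]] by blast
    define j where "j n = i (n + n1)" for n
    have j: "j n \<ge> n1" for n using i_ge[of "n + n1"] by (simp add: j_def)
    \<comment> \<open>The cut-offs make the system globally Lipschitz, as
      \<open>ode_sequence_limit\<close> requires, and by \<open>n1\<close> they are inactive on the
      approximations.\<close>
    define f where "f t x = (snd x, rhs t (clip m M (fst x)) (clip (- N) N (snd x)))" for t and x :: "real \<times> real"
    obtain L where L: "\<And>t x y. t \<in> {c..d} \<Longrightarrow>
      \<bar>rhs t (clip m M (fst x)) (clip (- N) N (snd x)) - rhs t (clip m M (fst y)) (clip (- N) N (snd y))\<bar>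
        \<le> L * norm (x - y)"
      using clipped_lipschitz[OF cd_E n1(1) less_imp_le[OF n1(2)]] by metis
    have f_lip: "norm (f t x - f t y) \<le> (1 + L) * norm (x - y)" if "t \<in> {c..d}" for t x y
      unfolding f_def by (intro second_order_system_lipschitz L that)
    have X: "((\<lambda>t. (U (j n) t, V (j n) t)) has_vector_derivative f t (U (j n) t, V (j n) t)) (at t within {c..d})"
      if t: "t \<in> {c..d}" for n t
    proof -
      have "U (j n) t \<in> {m..M}" "V (j n) t \<in> {- N..N}"
        using n1(4)[OF j t, of n] by (auto simp: abs_le_iff)
      then show ?thesis using solvesD[OF n1(3)[OF j] t, of n]
        by (simp add: f_def has_vector_derivative_Pair_iff clip_id)
    qed
    have lim_j: "(\<lambda>n. (U (j n) y0, V (j n) y0)) \<longlonglongrightarrow> l"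
      unfolding j_def by (rule LIMSEQ_ignore_initial_segment[OF lim])
    then obtain Y where Y: "\<And>t. t \<in> {c..d} \<Longrightarrow> (\<lambda>n. (U (j n) t, V (j n) t)) \<longlonglongrightarrow> Y t"
      "\<And>t. t \<in> {c..d} \<Longrightarrow> (Y has_vector_derivative f t (Y t)) (at t within {c..d})"
      using ode_sequence_limit[OF f_lip X _ lim_j] cd by auto
    have uv_lim: "(\<lambda>n. U (j n) t) \<longlonglongrightarrow> fst (Y t)" "(\<lambda>n. V (j n) t) \<longlonglongrightarrow> snd (Y t)" if "t \<in> {c..d}" for t
      using tendsto_fst[OF Y(1)[OF that]] tendsto_snd[OF Y(1)[OF that]] by simp_all
    have uv: "(u t, v t) = Y t" if "t \<in> {c..d}" for t
    proof -
      have "(\<lambda>n. U (i n) t) \<longlonglongrightarrow> fst (Y t)" "(\<lambda>n. V (i n) t) \<longlonglongrightarrow> snd (Y t)"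
        using uv_lim[OF that] unfolding j_def by (auto intro: LIMSEQ_offset)
      then show ?thesis by (simp add: u_def v_def limI)
    qed
    show ?thesis
      unfolding solves_def
    proof
      fix t assume t: "t \<in> {c..d}"
      have "((\<lambda>t. (u t, v t)) has_vector_derivative f t (u t, v t)) (at t within {c..d})"
        unfolding uv[OF t] by (rule has_vector_derivative_transform[OF t uv Y(2)[OF t]])
      then have d: "(u has_real_derivative v t) (at t within {c..d}) \<and>
          (v has_real_derivative rhs t (clip m M (u t)) (clip (- N) N (v t))) (at t within {c..d})"
        by (simp add: f_def has_vector_derivative_Pair_iff)
      \<comment> \<open>The limits stay in the closed box, so the cut-offs are inactive in the limit
        equation as well.\<close>
      have lims: "(\<lambda>n. U (j n) t) \<longlonglongrightarrow> u t" "(\<lambda>n. V (j n) t) \<longlonglongrightarrow> v t"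
        using uv_lim[OF t] uv[OF t, symmetric] by simp_all
      have "u t \<in> {m..M}"
        by (rule closed_sequentially[OF closed_atLeastAtMost _ lims(1)]) (use n1(4)[OF j t] in auto)
      moreover have "v t \<in> {- N..N}"
        by (rule closed_sequentially[OF closed_atLeastAtMost _ lims(2)])
           (use n1(4)[OF j t] in \<open>auto simp: abs_le_iff minus_le_iff\<close>)
      ultimately show "(u has_real_derivative v t) (at t within {c..d}) \<and>
          (v has_real_derivative rhs t (u t) (v t)) (at t within {c..d})"
        using d by (simp add: clip_id)
    qed
  qed
  have "(u has_real_derivative v t) (at t) \<and> (v has_real_derivative rhs t (u t) (v t)) (at t)"
    if t: "t \<in> E" for t
  proof -
    \<comment> \<open>The interval has to contain \<open>y0\<close>, where convergence is known; the
      margin puts \<open>t\<close> in its interior, so one-sided derivatives become full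
      ones.\<close>
    have "min t y0 \<in> E" "max t y0 \<in> E" using t y0 by (auto simp: min_def max_def)
    then obtain e where e: "e > 0" "{min t y0 - 2 * e..max t y0 + 2 * e} \<subseteq> E"
      using interval_enlarge[OF E] by metis
    let ?c = "min t y0 - 2 * e" and ?d = "max t y0 + 2 * e"
    have b: "?c < t" "t < ?d" "?c \<le> y0" "y0 \<le> ?d" using e(1) by auto
    then have "?c \<in> E" "?d \<in> E" using e(2) by auto
    from solvesD[OF sol[OF this b(3,4)], of t] b(1,2) show ?thesis
      by (simp add: at_within_Icc_at)
  qed
  then show thesis using that by blast
qed

end

lemma locally_lipschitz_on_continuous_on:
  assumes "open E" "locally_lipschitz_on E g"
  shows "continuous_on E g"
proof (rule continuous_at_imp_continuous_on, rule ballI)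
  fix x assume x: "x \<in> E"
  obtain r L where r: "r > 0" "L-lipschitz_on (cball x r \<inter> E) g"
    using assms(2) x unfolding locally_lipschitz_on_def by blast
  have "continuous_on (ball x r \<inter> E) g"
    by (rule continuous_on_subset[OF lipschitz_on_continuous_on[OF r(2)]]) auto
  then show "isCont g x"
    using x r(1) assms(1) by (simp add: continuous_on_eq_continuous_at open_Int)
qed

section \<open>The reduced HJB equation\<close>

text \<open>With \<open>f = exp u\<close> every term carries the factor \<open>f\<close>:
  \<open>f' = f * v\<close>, \<open>f'' = f * (v\<^sup>2 + w)\<close> and
  \<open>f'\<^sup>2 / f = f * v\<^sup>2\<close>. The \<open>v\<^sup>2\<close> from
  \<open>f''\<close> merges with the correlation term, which explains the quadratic coefficient in
  \<open>w\<close>.\<close>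

lemma hjb_exp_substitution:
  fixes u v w b \<eta> a \<rho> R :: real
  assumes R: "R \<noteq> 0" and b: "b \<noteq> 0"
    and w: "w = - (1 - (R - 1) / R * \<rho>\<^sup>2) * v\<^sup>2 - 2 * a / b\<^sup>2 * v + 2 * R / b\<^sup>2 * \<eta>
      - 2 * R / b\<^sup>2 * exp (- (1 / R) * u)"
  shows "0 = (1/2) * b\<^sup>2 * (exp u * (v\<^sup>2 + w)) + a * (exp u * v) - R * \<eta> * exp u
    + R * (exp u) powr (1 - 1 / R)
    + (1/2) * ((1 - R) / R) * \<rho>\<^sup>2 * b\<^sup>2 * (exp u * v)\<^sup>2 / exp u"
proof -
  have powr: "(exp u) powr (1 - 1 / R) = exp u * exp (- (1 / R) * u)"
    by (simp add: powr_def exp_add[symmetric] algebra_simps)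
  have sq: "(1/2) * ((1 - R) / R) * \<rho>\<^sup>2 * b\<^sup>2 * (exp u * v)\<^sup>2 / exp u
      = exp u * ((1/2) * ((1 - R) / R) * \<rho>\<^sup>2 * b\<^sup>2 * v\<^sup>2)"
    by (simp add: power2_eq_square)
  have "(1/2) * b\<^sup>2 * (v\<^sup>2 + w) + a * v - R * \<eta> + R * exp (- (1 / R) * u)
      + (1/2) * ((1 - R) / R) * \<rho>\<^sup>2 * b\<^sup>2 * v\<^sup>2 = 0"
    unfolding w using R b by (simp add: field_simps)
  then have "exp u * ((1/2) * b\<^sup>2 * (v\<^sup>2 + w) + a * v - R * \<eta> + R * exp (- (1 / R) * u)
      + (1/2) * ((1 - R) / R) * \<rho>\<^sup>2 * b\<^sup>2 * v\<^sup>2) = 0" by simp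
  then show ?thesis unfolding powr sq by (simp add: algebra_simps add_divide_distrib)
qed

theorem theorem4p3:
  fixes E :: "real set"
    and r lam \<sigma> a b \<rho> \<delta> :: "real \<Rightarrow> real"
    and R :: real
  assumes E_open: "open E" and E_interval: "is_interval E" and E_ne: "E \<noteq> {}"
    and lip: "locally_lipschitz_on E r" "locally_lipschitz_on E lam" "locally_lipschitz_on E \<sigma>"
             "locally_lipschitz_on E a" "locally_lipschitz_on E b" "locally_lipschitz_on E \<rho>"
             "locally_lipschitz_on E \<delta>"
    and sigma_pos: "\<forall>y\<in>E. \<sigma> y > 0"
    and b_nz: "\<forall>y\<in>E. b y \<noteq> 0"
    and rho_bd: "\<forall>y\<in>E. -1 \<le> \<rho> y \<and> \<rho> y \<le> 1"
    and R_gt: "R > 1"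
    and well_posed: "\<exists>C>0. \<forall>y\<in>E. eta_fun R \<delta> r lam y \<ge> C"
  shows "\<exists>f f' f'' :: real \<Rightarrow> real.
           (\<forall>y\<in>E. f y > 0) \<and>
           (\<forall>y\<in>E. (f has_real_derivative f' y) (at y)) \<and>
           (\<forall>y\<in>E. (f' has_real_derivative f'' y) (at y)) \<and>
           continuous_on E f'' \<and>
           (\<forall>y\<in>E. 0 = (1/2) * (b y)\<^sup>2 * f'' y
                      + atilde_fun R a \<rho> lam b y * f' y
                      - R * eta_fun R \<delta> r lam y * f y
                      + R * (f y) powr (1 - 1 / R)
                      + (1/2) * ((1 - R) / R) * (\<rho> y)\<^sup>2 * (b y)\<^sup>2 * (f' y)\<^sup>2 / f y)"
proof -
  obtain C where C: "C > 0" "\<forall>y\<in>E. eta_fun R \<delta> r lam y \<ge> C" using well_posed by blast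
  note c = locally_lipschitz_on_continuous_on[OF E_open]
  note cont = c[OF lip(1)] c[OF lip(2)] c[OF lip(4)] c[OF lip(5)] c[OF lip(6)] c[OF lip(7)]
  \<comment> \<open>The coefficients after division by \<open>(b y)\<^sup>2 / 2\<close>; pulling
    \<open>B\<close> out of \<open>P\<close> turns well-posedness into
    \<open>P \<ge> C * B\<close>.\<close>
  define q where "q y = 1 - (R - 1) / R * (\<rho> y)\<^sup>2" for y
  define A where "A y = 2 * atilde_fun R a \<rho> lam b y / (b y)\<^sup>2" for y
  define B where "B y = 2 * R / (b y)\<^sup>2" for y
  define P where "P y = B y * eta_fun R \<delta> r lam y" for y
  interpret riccati_ode E q A P B "1 / R" "1 / R" C
  proof
    show "continuous_on E q" unfolding q_def by (intro continuous_intros cont)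
    show "continuous_on E A" unfolding A_def atilde_fun_def
      using b_nz R_gt by (intro continuous_intros cont) auto
    show cB: "continuous_on E B" unfolding B_def using b_nz by (intro continuous_intros cont) auto
    show "continuous_on E P" unfolding P_def eta_fun_def
      using R_gt by (intro continuous_intros cont cB) auto
    show B_pos: "B t > 0" if "t \<in> E" for t using that b_nz R_gt by (simp add: B_def)
    show "P t \<ge> C * B t" if "t \<in> E" for t
      using that C(2) B_pos[OF that] by (simp add: P_def mult.commute)
    show "q t \<ge> 1 / R" if "t \<in> E" for t
    proof -
      \<comment> \<open>Since \<open>R > 1\<close>, the factor of \<open>\<rho>\<^sup>2\<close> is
        positive, and the extreme case \<open>\<rho>\<^sup>2 = 1\<close> leaves
        \<open>1 - (R - 1) / R = 1 / R\<close>.\<close>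
      have "(\<rho> t)\<^sup>2 \<le> 1" using rho_bd that by (simp add: abs_square_le_1 abs_le_iff minus_le_iff)
      then have "(R - 1) / R * (\<rho> t)\<^sup>2 \<le> (R - 1) / R * 1" using R_gt by (intro mult_left_mono) auto
      moreover have "(R - 1) / R = 1 - 1 / R" using R_gt by (simp add: field_simps)
      ultimately show ?thesis unfolding q_def by linarith
    qed
  qed (use E_open E_interval C R_gt in auto)
  obtain u v where uv: "\<And>t. t \<in> E \<Longrightarrow> (u has_real_derivative v t) (at t)"
    "\<And>t. t \<in> E \<Longrightarrow> (v has_real_derivative rhs t (u t) (v t)) (at t)"
    using global_solution[OF E_ne] by metis
  define f where "f t = exp (u t)" for t
  define f' where "f' t = exp (u t) * v t" for t
  define f'' where "f'' t = exp (u t) * ((v t)\<^sup>2 + rhs t (u t) (v t))" for t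
  have uv_cont: "continuous_on E u" "continuous_on E v"
    using uv by (auto intro!: continuous_at_imp_continuous_on DERIV_isCont)
  have "\<forall>y\<in>E. (f has_real_derivative f' y) (at y)"
    unfolding f_def f'_def by (auto intro!: derivative_eq_intros uv)
  moreover have "\<forall>y\<in>E. (f' has_real_derivative f'' y) (at y)"
    unfolding f'_def f''_def
    by (auto intro!: derivative_eq_intros uv simp: algebra_simps power2_eq_square)
  moreover have "continuous_on E f''"
    unfolding f''_def rhs_def by (intro continuous_intros uv_cont local.cont)
  moreover have "0 = (1/2) * (b y)\<^sup>2 * f'' y + atilde_fun R a \<rho> lam b y * f' y
      - R * eta_fun R \<delta> r lam y * f y + R * (f y) powr (1 - 1 / R)
      + (1/2) * ((1 - R) / R) * (\<rho> y)\<^sup>2 * (b y)\<^sup>2 * (f' y)\<^sup>2 / f y" if "y \<in> E" for y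
    unfolding f_def f'_def f''_def
    by (rule hjb_exp_substitution)
       (use that b_nz R_gt in \<open>auto simp: rhs_def q_def A_def P_def B_def\<close>)
  moreover have "\<forall>y\<in>E. f y > 0" by (simp add: f_def)
  ultimately show ?thesis by blast
qed

end
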